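(* Let $p,q$ be positive integers, $n=p+q$, $X=\{\pm1,\dots,\pm n\}$, $\gamma=(1,\dots,p,-1,\dots,-p)(p+1,\dots,n,-(p+1),\dots,-n)$. The map $\mathcal{S}^B_{nc}(p,q)\ni\tau\mapsto\widetilde{\Omega}(\tau)\in NC^B(p,q)$ is bijective and is a poset isomorphism, where $\mathcal{S}^B_{nc}(p,q)$ carries the partial order induced from $B_n$ and $NC^B(p,q)$ is ordered by reverse refinement.
   Context: $B_n$ is the group of permutations $\tau$ of $X$ with $\tau(-i)=-\tau(i)$. For a permutation $\sigma$ of a finite set $S$, $\#(\sigma)$ is its number of orbits; $\#(\tau,\gamma)$ is the number of orbits of the group generated by $\tau,\gamma$. $\mathcal{S}_{nc}(S,\gamma)=\{\tau\mid \#(\tau)+\#(\tau^{-1}\gamma)+\#(\gamma)=|S|+2\#(\tau,\gamma)\}$, and $\mathcal{S}^B_{nc}(p,q)=\mathcal{S}_{nc}(X,\gamma)\cap B_n$. The length $\ell_B(\tau)$ is the minimal number of factors needed to write $\tau$ as a product of elements of $\{(i,j)(-i,-j),(i,-j)(-i,j):1\le i<j\le n\}\cup\{(i,-i):1\le i\le n\}$; $\sigma\le\tau$ in $B_n$ iff $\ell_B(\tau)=\ell_B(\sigma)+\ell_B(\sigma^{-1}\tau)$. For $\tau\in B_n$, $\Omega(\tau)$ is the partition of $X$ into orbits of $\tau$; a block $A$ with $A=-A$ is called a zero-block (inversion-invariant). $\widetilde{\Omega}(\tau)$ is the partition obtained from $\Omega(\tau)$ by merging all its zero-blocks (if any) into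 a single block, keeping all other blocks. $NC^B(p,q)=\{\widetilde{\Omega}(\tau)\mid\tau\in\mathcal{S}^B_{nc}(p,q)\}$. Reverse refinement: $\pi\le\rho$ iff every block of $\rho$ is a union of blocks of $\pi$. *)

theory Defs
  imports
    "HOL-Algebra.Group_Action"
    "HOL-Algebra.Generated_Groups"
    "HOL-Combinatorics.Cycles"
    "HOL-Combinatorics.Orbits"
begin

text \<open>For a permutation of a finite set the forward orbit is the full orbit; in particular it
  contains its base point, so fixed points are counted.\<close>
definition perm_orbits :: "'a set \<Rightarrow> ('a \<Rightarrow> 'a) \<Rightarrow> 'a set set" where
  "perm_orbits S \<sigma> = {Orbits.orbit \<sigma> x | x. x \<in> S}"

definition perm_group :: "'a set \<Rightarrow> ('a \<Rightarrow> 'a) monoid" where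
  "perm_group S = \<lparr>carrier = {\<sigma>. \<sigma> permutes S}, monoid.mult = (\<circ>), one = id\<rparr>"

definition joint_orbits :: "'a set \<Rightarrow> ('a \<Rightarrow> 'a) \<Rightarrow> ('a \<Rightarrow> 'a) \<Rightarrow> 'a set set" where
  "joint_orbits S \<tau> \<gamma> =
     orbits (perm_group S \<lparr>carrier := generate (perm_group S) {\<tau>, \<gamma>}\<rparr>) S (\<lambda>g. g)"

definition S_nc :: "'a set \<Rightarrow> ('a \<Rightarrow> 'a) \<Rightarrow> ('a \<Rightarrow> 'a) set" where
  "S_nc S \<gamma> = {\<tau>. \<tau> permutes S \<and>
     card (perm_orbits S \<tau>) + card (perm_orbits S (Hilbert_Choice.inv \<tau> \<circ> \<gamma>))
       + card (perm_orbits S \<gamma>)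
     = card S + 2 * card (joint_orbits S \<tau> \<gamma>)}"

definition signed_set :: "nat \<Rightarrow> int set" where
  "signed_set n = {i. 1 \<le> \<bar>i\<bar> \<and> \<bar>i\<bar> \<le> int n}"

definition B_group :: "nat \<Rightarrow> (int \<Rightarrow> int) set" where
  "B_group n = {\<tau>. \<tau> permutes signed_set n \<and> (\<forall>i\<in>signed_set n. \<tau> (- i) = - \<tau> i)}"

definition B_reflections :: "nat \<Rightarrow> (int \<Rightarrow> int) set" where
  "B_reflections n =
     {Transposition.transpose i j \<circ> Transposition.transpose (- i) (- j) | i j.
        1 \<le> i \<and> i < j \<and> j \<le> int n}
   \<union> {Transposition.transpose i (- j) \<circ> Transposition.transpose (- i) j | i j.
        1 \<le> i \<and> i < j \<and> j \<le> int n}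
   \<union> {Transposition.transpose i (- i) | i. 1 \<le> i \<and> i \<le> int n}"

text \<open>The minimum is meaningful for elements of \<^term>\<open>B_group n\<close>, which the reflections
  generate; elsewhere the value is unspecified.\<close>
definition B_length :: "nat \<Rightarrow> (int \<Rightarrow> int) \<Rightarrow> nat" where
  "B_length n \<tau> =
     (LEAST k. \<exists>ts. length ts = k \<and> set ts \<subseteq> B_reflections n \<and> foldr (\<circ>) ts id = \<tau>)"

definition B_le :: "nat \<Rightarrow> (int \<Rightarrow> int) \<Rightarrow> (int \<Rightarrow> int) \<Rightarrow> bool" where
  "B_le n \<sigma> \<tau> \<longleftrightarrow> B_length n \<tau> = B_length n \<sigma> + B_length n (Hilbert_Choice.inv \<sigma> \<circ> \<tau>)"

definition annular_gamma :: "nat \<Rightarrow> nat \<Rightarrow> int \<Rightarrow> int" where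
  "annular_gamma p q =
     cycle_of_list ([1..int p] @ map uminus [1..int p]) \<circ>
     cycle_of_list ([int p + 1..int (p + q)] @ map uminus [int p + 1..int (p + q)])"

definition S_ncB :: "nat \<Rightarrow> nat \<Rightarrow> (int \<Rightarrow> int) set" where
  "S_ncB p q = S_nc (signed_set (p + q)) (annular_gamma p q) \<inter> B_group (p + q)"

definition zero_blocks :: "int set set \<Rightarrow> int set set" where
  "zero_blocks \<pi> = {A \<in> \<pi>. A = uminus ` A}"

definition Omega :: "nat \<Rightarrow> (int \<Rightarrow> int) \<Rightarrow> int set set" where
  "Omega n \<tau> = perm_orbits (signed_set n) \<tau>"

definition Omega_tilde :: "nat \<Rightarrow> (int \<Rightarrow> int) \<Rightarrow> int set set" where
  "Omega_tilde n \<tau> =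
     (let \<pi> = Omega n \<tau>; Z = zero_blocks \<pi>
      in if Z = {} then \<pi> else insert (\<Union> Z) (\<pi> - Z))"

definition NCB :: "nat \<Rightarrow> nat \<Rightarrow> int set set set" where
  "NCB p q = {Omega_tilde (p + q) \<tau> | \<tau>. \<tau> \<in> S_ncB p q}"

definition rev_refines :: "'a set set \<Rightarrow> 'a set set \<Rightarrow> bool" where
  "rev_refines \<pi> \<rho> \<longleftrightarrow> (\<forall>B\<in>\<rho>. \<exists>C\<subseteq>\<pi>. B = \<Union> C)"

definition induced_order :: "'a set \<Rightarrow> ('a \<Rightarrow> 'a \<Rightarrow> bool) \<Rightarrow> 'a rel" where
  "induced_order A R = {(x, y). x \<in> A \<and> y \<in> A \<and> R x y}"

definition poset_isomorphism ::
  "'a set \<Rightarrow> 'a rel \<Rightarrow> 'b set \<Rightarrow> 'b rel \<Rightarrow> ('a \<Rightarrow> 'b) \<Rightarrow> bool" where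
  "poset_isomorphism A r B s f \<longleftrightarrow>
     partial_order_on A r \<and> partial_order_on B s \<and> bij_betw f A B \<and>
     (\<forall>x\<in>A. \<forall>y\<in>A. (x, y) \<in> r \<longleftrightarrow> (f x, f y) \<in> s)"

end

theory Submission
  imports Defs "HOL-Library.Numeral_Type" "HOL-Library.Function_Algebras" "HOL-Library.Product_Plus"
begin

text \<open>Attach to \<open>\<tau> \<in> B\<^sub>n\<close> the space \<open>Fix \<tau>\<close> of odd \<open>\<tau>\<close>-invariant functions \<open>X \<rightarrow> \<int>/3\<close>; over a finite field
  of odd characteristic, dimensions can be handled by counting. Three facts give the theorem.
  First, the length of \<open>\<tau>\<close> is the codimension of \<open>Fix \<tau>\<close>, and the merged orbit partition of \<open>\<tau>\<close>
  records exactly which points are not separated by \<open>Fix \<tau>\<close>, so reverse refinement is reverse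
  inclusion of these spaces. Second, every noncrossing \<open>\<tau>\<close> lies below \<open>\<gamma>\<close> in \<open>B\<^sub>n\<close>: the genus zero
  condition determines the number of all functions invariant under \<open>\<tau>\<close> and under \<open>\<tau>\<^sup>-\<^sup>1\<gamma>\<close>, and the
  even ones are bounded by an orthogonality argument. Third, as Brady and Watt observed for the
  orthogonal group, below a fixed \<open>\<gamma>\<close> the order is reverse inclusion of the spaces \<open>Fix \<tau>\<close>. The only
  property of \<open>\<gamma>\<close> that matters is that all its orbits are inversion-invariant, that is,
  \<open>Fix \<gamma> = 0\<close>.\<close>

section \<open>Arithmetic in the field with three elements\<close>

lemma three_cases: "(x :: 3) = 0 \<or> x = 1 \<or> x = - 1"
proof -
  have "card {0, 1, - 1 :: 3} = card (UNIV :: 3 set)" by simp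
  then have "{0, 1, - 1 :: 3} = UNIV" by (intro card_subset_eq) auto
  then show ?thesis by auto
qed

lemma three_double_eq_zero: "(x :: 3) + x = 0 \<Longrightarrow> x = 0"
  using three_cases[of x] by auto

lemma three_eq_minus_iff: "(x :: 3) = - x \<longleftrightarrow> x = 0"
  using three_cases[of x] by auto

section \<open>Counting and duality in finite abelian groups\<close>

definition additive_subgroup :: "'a::ab_group_add set \<Rightarrow> bool" where
  "additive_subgroup H \<longleftrightarrow> 0 \<in> H \<and> (\<forall>a\<in>H. \<forall>b\<in>H. a - b \<in> H)"

lemma additive_subgroup_zero: "additive_subgroup H \<Longrightarrow> 0 \<in> H"
  and additive_subgroup_diff: "additive_subgroup H \<Longrightarrow> a \<in> H \<Longrightarrow> b \<in> H \<Longrightarrow> a - b \<in> H"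
  by (auto simp: additive_subgroup_def)

lemma additive_subgroup_add:
  assumes "additive_subgroup H" "a \<in> H" "b \<in> H"
  shows "a + b \<in> H"
proof -
  have "0 - b \<in> H" using assms by (simp add: additive_subgroup_def del: diff_0)
  then have "a - (0 - b) \<in> H" using assms by (simp add: additive_subgroup_def del: diff_0)
  then show ?thesis by simp
qed

lemma additive_subgroup_Int:
  "additive_subgroup H \<Longrightarrow> additive_subgroup K \<Longrightarrow> additive_subgroup (H \<inter> K)"
  by (auto simp: additive_subgroup_def)

lemma additive_subgroup_Times:
  "additive_subgroup H \<Longrightarrow> additive_subgroup K \<Longrightarrow> additive_subgroup (H \<times> K)"
  by (auto simp: additive_subgroup_def zero_prod_def)

text \<open>Every nonempty fibre has the size of the kernel: for a fixed preimage \<open>a\<close>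
  of \<open>y\<close>, the map sending \<open>h\<close> to \<open>a - h\<close> exchanges the kernel
  with the fibre over \<open>y\<close>.\<close>

lemma card_image_times_kernel:
  fixes \<phi> :: "'a::ab_group_add \<Rightarrow> 'b::ab_group_add"
  assumes "finite H" and H: "additive_subgroup H"
    and \<phi>: "\<And>a b. a \<in> H \<Longrightarrow> b \<in> H \<Longrightarrow> \<phi> (a - b) = \<phi> a - \<phi> b"
  shows "card H = card (\<phi> ` H) * card {h \<in> H. \<phi> h = 0}"
proof -
  let ?K = "{h \<in> H. \<phi> h = 0}"
  have "card {h \<in> H. \<phi> h = y} = card ?K" if "y \<in> \<phi> ` H" for y
  proof -
    from that obtain a where a: "a \<in> H" "y = \<phi> a" by auto
    have "bij_betw (\<lambda>h. a - h) ?K {h \<in> H. \<phi> h = y}"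
      by (rule bij_betw_byWitness[where f' = "\<lambda>h. a - h"])
        (use a H \<phi> in \<open>auto simp: additive_subgroup_diff\<close>)
    then show ?thesis by (simp add: bij_betw_same_card)
  qed
  moreover have "card H = (\<Sum>y\<in>\<phi> ` H. card {h \<in> H. \<phi> h = y})"
    using sum.image_gen[OF \<open>finite H\<close>, of "\<lambda>_. 1::nat" \<phi>] by simp
  ultimately show ?thesis by simp
qed

text \<open>The kernel of the difference map is the diagonal copy of \<open>H \<inter> K\<close>.
  The differences form the sum of the two subgroups, so this is the dimension formula for sum and
  intersection.\<close>

lemma card_diffs_times_Int:
  fixes H K :: "'a::ab_group_add set"
  assumes "finite H" "finite K" "additive_subgroup H" "additive_subgroup K"
  shows "card H * card K = card ((\<lambda>(h, k). h - k) ` (H \<times> K)) * card (H \<inter> K)"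
proof -
  have "{x \<in> H \<times> K. (case x of (h, k) \<Rightarrow> h - k) = 0} = (\<lambda>h. (h, h)) ` (H \<inter> K)"
    by auto
  moreover have "card ((\<lambda>h. (h, h)) ` (H \<inter> K)) = card (H \<inter> K)"
    by (rule card_image) (auto intro: inj_onI)
  ultimately show ?thesis
    using card_image_times_kernel[of "H \<times> K" "\<lambda>(h, k). h - k"] assms
    by (simp add: additive_subgroup_Times card_cartesian_product split_beta)
qed

text \<open>Counting form of the fact that codimensions at most add up under intersection.\<close>

lemma card_mult_le_card_Int:
  fixes H K :: "'a::ab_group_add set"
  assumes "finite V" "additive_subgroup V" "additive_subgroup H" "additive_subgroup K"
    and "H \<subseteq> V" "K \<subseteq> V"
  shows "card H * card K \<le> card V * card (H \<inter> K)"
proof -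
  have "(\<lambda>(h, k). h - k) ` (H \<times> K) \<subseteq> V"
    using assms by (auto simp: additive_subgroup_diff subset_iff)
  then have "card ((\<lambda>(h, k). h - k) ` (H \<times> K)) \<le> card V"
    using assms by (simp add: card_mono)
  then show ?thesis
    using card_diffs_times_Int[of H K] assms by (simp add: finite_subset)
qed

text \<open>The trace of a nontrivial additive character of \<open>\<int>/3\<close>, which makes character sums
  available over the integers.\<close>
definition trace3 :: "3 \<Rightarrow> int" where
  "trace3 x = (if x = 0 then 2 else - 1)"

lemma trace3_sum: "b \<noteq> 0 \<Longrightarrow> trace3 a + trace3 (a + b) + trace3 (a + b + b) = 0"
  using three_cases[of a] three_cases[of b] by (auto simp: trace3_def)

text \<open>Orthogonality of characters. If \<open>\<phi> b\<close> is nonzero, the sum is unchanged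
  when \<open>h\<close> is shifted by \<open>b\<close> or \<open>b + b\<close>, and the three sums
  cancel term by term by \<open>trace3_sum\<close>.\<close>

lemma sum_trace3:
  fixes \<phi> :: "'a::ab_group_add \<Rightarrow> 3"
  assumes "finite H" and H: "additive_subgroup H"
    and \<phi>: "\<And>a b. a \<in> H \<Longrightarrow> b \<in> H \<Longrightarrow> \<phi> (a + b) = \<phi> a + \<phi> b"
  shows "(\<Sum>h\<in>H. trace3 (\<phi> h)) = (if \<forall>h\<in>H. \<phi> h = 0 then 2 * int (card H) else 0)"
proof (cases "\<forall>h\<in>H. \<phi> h = 0")
  case True
  then show ?thesis by (simp add: trace3_def)
next
  case False
  then obtain b where b: "b \<in> H" "\<phi> b \<noteq> 0" by auto
  have shift: "(\<Sum>h\<in>H. f (h + c)) = (\<Sum>h\<in>H. f h)" if "c \<in> H" for c and f :: "'a \<Rightarrow> int"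
    by (rule sum.reindex_bij_witness[where i = "\<lambda>h. h - c" and j = "\<lambda>h. h + c"])
      (use that H in \<open>auto simp: additive_subgroup_diff additive_subgroup_add\<close>)
  have "3 * (\<Sum>h\<in>H. trace3 (\<phi> h)) =
    (\<Sum>h\<in>H. trace3 (\<phi> h)) + (\<Sum>h\<in>H. trace3 (\<phi> (h + b))) + (\<Sum>h\<in>H. trace3 (\<phi> (h + (b + b))))"
    using shift[of b "\<lambda>h. trace3 (\<phi> h)"] shift[of "b + b" "\<lambda>h. trace3 (\<phi> h)"] b H
    by (simp add: additive_subgroup_add)
  also have "\<dots> = (\<Sum>h\<in>H. trace3 (\<phi> h) + trace3 (\<phi> h + \<phi> b) + trace3 (\<phi> h + \<phi> b + \<phi> b))"
    using b H by (simp add: sum.distrib \<phi> additive_subgroup_add add.assoc)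
  also have "\<dots> = 0" using trace3_sum[OF b(2)] by (intro sum.neutral) blast
  finally show ?thesis using False by auto
qed

text \<open>Double counting of \<open>trace3 (\<beta> v w)\<close> over all pairs. Summing over
  \<open>w\<close> first leaves the \<open>v\<close> orthogonal to \<open>W\<close>; summing over
  \<open>v\<close> first leaves only \<open>w = 0\<close>, by nondegeneracy.\<close>

lemma card_perp:
  fixes V :: "'a::ab_group_add set" and W :: "'b::ab_group_add set" and \<beta> :: "'a \<Rightarrow> 'b \<Rightarrow> 3"
  assumes V: "finite V" "additive_subgroup V" and W: "finite W" "additive_subgroup W"
    and add1: "\<And>a b w. \<beta> (a + b) w = \<beta> a w + \<beta> b w"
    and add2: "\<And>v a b. \<beta> v (a + b) = \<beta> v a + \<beta> v b"
    and nondeg: "\<And>w. w \<in> W \<Longrightarrow> (\<And>v. v \<in> V \<Longrightarrow> \<beta> v w = 0) \<Longrightarrow> w = 0"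
  shows "card W * card {v \<in> V. \<forall>w\<in>W. \<beta> v w = 0} = card V"
proof -
  let ?P = "{v \<in> V. \<forall>w\<in>W. \<beta> v w = 0}"
  have z: "\<beta> v 0 = 0" for v using add2[of v 0 0] by simp
  have "2 * int (card W) * int (card ?P) = (\<Sum>v\<in>?P. 2 * int (card W))" by simp
  also have "\<dots> = (\<Sum>v\<in>V. if \<forall>w\<in>W. \<beta> v w = 0 then 2 * int (card W) else 0)"
    using V by (intro sum.inter_filter)
  also have "\<dots> = (\<Sum>v\<in>V. \<Sum>w\<in>W. trace3 (\<beta> v w))"
    by (intro sum.cong refl) (simp add: sum_trace3 W add2)
  also have "\<dots> = (\<Sum>w\<in>W. \<Sum>v\<in>V. trace3 (\<beta> v w))" by (rule sum.swap)
  also have "\<dots> = (\<Sum>w\<in>W. if \<forall>v\<in>V. \<beta> v w = 0 then 2 * int (card V) else 0)"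
    by (intro sum.cong refl) (simp add: sum_trace3 V add1)
  also have "\<dots> = (\<Sum>w\<in>W. if w = 0 then 2 * int (card V) else 0)"
  proof (intro sum.cong refl)
    fix w assume "w \<in> W"
    then have "(\<forall>v\<in>V. \<beta> v w = 0) \<longleftrightarrow> w = 0" using nondeg[of w] z by auto
    then show "(if \<forall>v\<in>V. \<beta> v w = 0 then 2 * int (card V) else 0) =
      (if w = 0 then 2 * int (card V) else 0)" by simp
  qed
  also have "\<dots> = 2 * int (card V)"
    using W by (simp add: additive_subgroup_zero)
  finally have "int (card W * card ?P) = int (card V)" by simp
  then show ?thesis by linarith
qed

section \<open>Length and invariant functions\<close>

text \<open>Functions on \<open>X\<close> are encoded as functions on all integers vanishing outside
  \<open>X\<close>, so that their equality is plain equality and the space is finite.\<close>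

definition fun_space :: "nat \<Rightarrow> (int \<Rightarrow> 3) set" where
  "fun_space n = {f. \<forall>x. x \<notin> signed_set n \<longrightarrow> f x = 0}"

text \<open>The sign \<open>s\<close> is meant to be \<open>1\<close> or \<open>- 1\<close>; even
  and odd functions then share the lemmas on dimension and duality, under the hypothesis
  \<open>s * s = 1\<close>.\<close>

definition parity_space :: "nat \<Rightarrow> 3 \<Rightarrow> (int \<Rightarrow> 3) set" where
  "parity_space n s = {f \<in> fun_space n. \<forall>x. f (- x) = s * f x}"

abbreviation odd_space :: "nat \<Rightarrow> (int \<Rightarrow> 3) set" where
  "odd_space n \<equiv> parity_space n (- 1)"

abbreviation even_space :: "nat \<Rightarrow> (int \<Rightarrow> 3) set" where
  "even_space n \<equiv> parity_space n 1"

definition fixed_funs :: "(int \<Rightarrow> 3) set \<Rightarrow> (int \<Rightarrow> int) \<Rightarrow> (int \<Rightarrow> 3) set" where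
  "fixed_funs V \<tau> = {f \<in> V. f \<circ> \<tau> = f}"

definition dot :: "nat \<Rightarrow> (int \<Rightarrow> 3) \<Rightarrow> (int \<Rightarrow> 3) \<Rightarrow> 3" where
  "dot n f g = (\<Sum>x\<in>signed_set n. f x * g x)"

lemma uminus_in_signed_set [simp]: "- x \<in> signed_set n \<longleftrightarrow> x \<in> signed_set n"
  by (auto simp: signed_set_def)

lemma finite_signed_set [simp]: "finite (signed_set n)"
  by (rule finite_subset[of _ "{- int n..int n}"]) (auto simp: signed_set_def)

lemma zero_notin_signed_set [simp]: "0 \<notin> signed_set n"
  by (simp add: signed_set_def)

lemma finite_fun_space [simp]: "finite (fun_space n)"
  using finite_set_of_finite_funs[of "signed_set n" "UNIV :: 3 set" 0]
  by (simp add: fun_space_def)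

lemma finite_parity_space [simp]: "finite (parity_space n s)"
  by (simp add: parity_space_def)

lemma finite_fixed_funs [simp]: "finite V \<Longrightarrow> finite (fixed_funs V \<tau>)"
  by (simp add: fixed_funs_def)

lemma additive_subgroup_fun_space [simp]: "additive_subgroup (fun_space n)"
  by (simp add: additive_subgroup_def fun_space_def fun_diff_def)

lemma additive_subgroup_parity_space [simp]: "additive_subgroup (parity_space n s)"
  by (auto simp: additive_subgroup_def parity_space_def fun_space_def fun_diff_def algebra_simps)

lemma additive_subgroup_fixed_funs [simp]:
  "additive_subgroup V \<Longrightarrow> additive_subgroup (fixed_funs V \<tau>)"
  by (auto simp: additive_subgroup_def fixed_funs_def fun_diff_def fun_eq_iff)

lemma fixed_funs_subset: "fixed_funs V \<tau> \<subseteq> V"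
  by (auto simp: fixed_funs_def)

lemma card_parity_space:
  assumes s: "s * s = 1"
  shows "card (parity_space n s) = 3 ^ n"
proof -
  let ?P = "{1..int n}"
  let ?g = "\<lambda>g x. if x \<in> ?P then g x else if - x \<in> ?P then s * g (- x) else (0::3)"
  have ss: "s * (s * a) = a" for a using s by (metis mult.assoc mult_1)
  have "bij_betw (\<lambda>f. restrict f ?P) (parity_space n s) (?P \<rightarrow>\<^sub>E UNIV)"
  proof (rule bij_betw_byWitness[where f' = ?g])
    show "\<forall>f\<in>parity_space n s. ?g (restrict f ?P) = f"
    proof (intro ballI ext)
      fix f x assume "f \<in> parity_space n s"
      then have f: "\<And>x. x \<notin> signed_set n \<Longrightarrow> f x = 0" "\<And>x. f (- x) = s * f x"
        by (auto simp: parity_space_def fun_space_def)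
      show "?g (restrict f ?P) x = f x"
        using f(1)[of x] f(2)[of x] by (auto simp: ss signed_set_def)
    qed
    show "\<forall>g\<in>?P \<rightarrow>\<^sub>E UNIV. restrict (?g g) ?P = g"
      by (auto simp: fun_eq_iff restrict_def PiE_def extensional_def)
    show "(\<lambda>f. restrict f ?P) ` parity_space n s \<subseteq> ?P \<rightarrow>\<^sub>E UNIV" by auto
    show "?g ` (?P \<rightarrow>\<^sub>E UNIV) \<subseteq> parity_space n s"
      by (auto simp: parity_space_def fun_space_def signed_set_def ss)
  qed
  then show ?thesis by (simp add: bij_betw_same_card card_funcsetE)
qed

lemma dot_add_left: "dot n (f + g) h = dot n f h + dot n g h"
  and dot_add_right: "dot n f (g + h) = dot n f g + dot n f h"
  and dot_diff_left: "dot n (f - g) h = dot n f h - dot n g h"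
  and dot_diff_right: "dot n f (g - h) = dot n f g - dot n f h"
  by (simp_all add: dot_def sum.distrib sum_subtractf algebra_simps)

lemma dot_comp:
  assumes "\<tau> permutes signed_set n"
  shows "dot n (f \<circ> \<tau>) (g \<circ> \<tau>) = dot n f g"
  unfolding dot_def using sum.permute[OF assms, of "\<lambda>x. f x * g x"] by (simp add: comp_def)

definition delta :: "3 \<Rightarrow> int \<Rightarrow> int \<Rightarrow> 3" where
  "delta s i = (\<lambda>x. if x = i then 1 else if x = - i then s else 0)"

lemma delta_in_parity_space:
  assumes "i \<in> signed_set n" "s * s = 1"
  shows "delta s i \<in> parity_space n s"
  using assms by (auto simp: parity_space_def fun_space_def delta_def)

lemma dot_delta:
  assumes i: "i \<in> signed_set n" and "s * s = 1" and "w \<in> parity_space n s"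
  shows "dot n (delta s i) w = w i + w i"
proof -
  have "i \<noteq> - i" using i by (auto simp: signed_set_def)
  have "dot n (delta s i) w = (\<Sum>x\<in>{i, - i}. delta s i x * w x)"
    unfolding dot_def by (rule sum.mono_neutral_right) (use i in \<open>auto simp: delta_def\<close>)
  also have "\<dots> = w i + s * (s * w i)"
    using assms \<open>i \<noteq> - i\<close> by (auto simp: delta_def parity_space_def)
  also have "s * (s * w i) = w i" using \<open>s * s = 1\<close> by (metis mult.assoc mult_1)
  finally show ?thesis .
qed

text \<open>The pairing is nondegenerate on a parity space: \<open>delta s i\<close> pairs with
  \<open>w\<close> to twice \<open>w i\<close>, and 2 is invertible modulo 3.\<close>

lemma card_perp_parity_space:
  assumes s: "s * s = 1" and W: "additive_subgroup W" "W \<subseteq> parity_space n s"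
  shows "card W * card {v \<in> parity_space n s. \<forall>w\<in>W. dot n v w = 0} = 3 ^ n"
proof -
  have "w = 0" if "w \<in> W" "\<And>v. v \<in> parity_space n s \<Longrightarrow> dot n v w = 0" for w
  proof
    fix i
    have w: "w \<in> parity_space n s" using that W by auto
    show "w i = 0 i"
    proof (cases "i \<in> signed_set n")
      case True
      then show ?thesis
        using that(2)[OF delta_in_parity_space[OF True s]] dot_delta[OF True s w]
        by (simp add: three_double_eq_zero)
    next
      case False
      then show ?thesis using w by (simp add: parity_space_def fun_space_def)
    qed
  qed
  then show ?thesis
    using card_perp[of "parity_space n s" W "dot n"] W s
    by (simp add: dot_add_left dot_add_right card_parity_space finite_subset[of W "parity_space n s"])
qed

section \<open>Signed permutations and reflections\<close>

lemma B_group_permutes: "\<tau> \<in> B_group n \<Longrightarrow> \<tau> permutes signed_set n"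
  by (simp add: B_group_def)

lemma B_group_uminus: "\<tau> \<in> B_group n \<Longrightarrow> \<tau> (- x) = - \<tau> x"
  unfolding B_group_def by (cases "x \<in> signed_set n") (auto simp: permutes_not_in)

lemma B_groupI:
  "\<tau> permutes signed_set n \<Longrightarrow> (\<And>x. x \<in> signed_set n \<Longrightarrow> \<tau> (- x) = - \<tau> x) \<Longrightarrow> \<tau> \<in> B_group n"
  by (simp add: B_group_def)

lemma B_group_comp: "\<sigma> \<in> B_group n \<Longrightarrow> \<tau> \<in> B_group n \<Longrightarrow> \<sigma> \<circ> \<tau> \<in> B_group n"
  by (intro B_groupI) (auto simp: B_group_permutes B_group_uminus permutes_compose)

lemma B_group_inv:
  assumes "\<tau> \<in> B_group n"
  shows "Hilbert_Choice.inv \<tau> \<in> B_group n"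
proof (intro B_groupI)
  have p: "\<tau> permutes signed_set n" using assms by (rule B_group_permutes)
  then show "Hilbert_Choice.inv \<tau> permutes signed_set n" by (rule permutes_inv)
  fix x
  have "\<tau> (- Hilbert_Choice.inv \<tau> x) = - x"
    using p by (simp add: B_group_uminus[OF assms] permutes_inverses)
  then show "Hilbert_Choice.inv \<tau> (- x) = - Hilbert_Choice.inv \<tau> x"
    using p by (metis permutes_inverses(2))
qed

lemma comp_in_parity_space:
  assumes "f \<in> parity_space n s" "\<tau> \<in> B_group n"
  shows "f \<circ> \<tau> \<in> parity_space n s"
  using assms B_group_permutes[OF assms(2)]
  by (auto simp: parity_space_def fun_space_def B_group_uminus permutes_not_in)

text \<open>One formula for all three families of reflections, with \<open>i\<close> and
  \<open>j\<close> of any sign. For \<open>j = - i\<close> the two transpositions coincide and would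
  cancel, hence the separate case.\<close>

definition B_refl :: "int \<Rightarrow> int \<Rightarrow> int \<Rightarrow> int" where
  "B_refl i j = (if j = - i then Transposition.transpose i j
     else Transposition.transpose i j \<circ> Transposition.transpose (- i) (- j))"

lemma B_refl_apply:
  assumes "i \<noteq> 0" "j \<noteq> 0" "i \<noteq> j"
  shows "B_refl i j x = (if x = i then j else if x = j then i else
    if x = - i then - j else if x = - j then - i else x)"
  using assms by (auto simp: B_refl_def Transposition.transpose_def)

text \<open>The symmetries \<open>sym\<close> reduce to positive \<open>i\<close> smaller than the
  absolute value of \<open>j\<close>, where the sign of \<open>j\<close> selects the family;
  \<open>i = - j\<close> is treated apart.\<close>

lemma B_refl_in_B_reflections:
  assumes "i \<in> signed_set n" "j \<in> signed_set n" "i \<noteq> j"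
  shows "B_refl i j \<in> B_reflections n"
proof -
  have nz: "i \<noteq> 0" "j \<noteq> 0" using assms by auto
  have main: "B_refl i j \<in> B_reflections n" if "1 \<le> i" "i < \<bar>j\<bar>" "\<bar>j\<bar> \<le> int n" for i j
  proof (cases "j > 0")
    case True
    then show ?thesis using that unfolding B_reflections_def B_refl_def by auto
  next
    case False
    then have "B_refl i j = Transposition.transpose i (- (- j)) \<circ> Transposition.transpose (- i) (- j)"
      using that by (auto simp: B_refl_def)
    then show ?thesis using that False unfolding B_reflections_def
      by (intro UnI1 UnI2 CollectI exI[of _ i] exI[of _ "- j"]) auto
  qed
  have sym: "B_refl i j = B_refl j i" "B_refl i j = B_refl (- i) (- j)"
    if "i \<noteq> 0" "j \<noteq> 0" "i \<noteq> j" for i j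
    using that by (auto simp: fun_eq_iff B_refl_apply)
  have main': "B_refl i j \<in> B_reflections n"
    if "\<bar>i\<bar> < \<bar>j\<bar>" "i \<noteq> 0" "\<bar>j\<bar> \<le> int n" for i j
  proof (cases "i > 0")
    case True
    then show ?thesis using main[of i j] that by auto
  next
    case False
    then show ?thesis using main[of "- i" "- j"] sym(2)[of i j] that by auto
  qed
  consider "\<bar>i\<bar> < \<bar>j\<bar>" | "\<bar>j\<bar> < \<bar>i\<bar>" | "i = - j" using assms(3) by linarith
  then show ?thesis
  proof cases
    case 1
    then show ?thesis using main'[of i j] assms nz by (auto simp: signed_set_def)
  next
    case 2
    then show ?thesis using main'[of j i] sym(1)[of i j] assms nz by (auto simp: signed_set_def)
  next
    case 3
    have "Transposition.transpose k (- k) \<in> B_reflections n" if "1 \<le> k" "k \<le> int n" for k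
      using that unfolding B_reflections_def by auto
    from this[of i] this[of j] 3 show ?thesis
      using assms by (cases "i > 0") (auto simp: B_refl_def signed_set_def transpose_commute)
  qed
qed

lemma B_reflections_cases:
  assumes "t \<in> B_reflections n"
  obtains i j where "i \<in> signed_set n" "j \<in> signed_set n" "i \<noteq> j" "t = B_refl i j"
proof -
  consider i j where "1 \<le> i" "i < j" "j \<le> int n"
      "t = Transposition.transpose i j \<circ> Transposition.transpose (- i) (- j)"
    | i j where "1 \<le> i" "i < j" "j \<le> int n"
      "t = Transposition.transpose i (- j) \<circ> Transposition.transpose (- i) j"
    | i where "1 \<le> i" "i \<le> int n" "t = Transposition.transpose i (- i)"
    using assms unfolding B_reflections_def by blast
  then show thesis
  proof cases
    case (1 i j)
    then show thesis using that[of i j] by (auto simp: signed_set_def B_refl_def)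
  next
    case (2 i j)
    then show thesis using that[of i "- j"] by (auto simp: signed_set_def B_refl_def)
  next
    case (3 i)
    then show thesis using that[of i "- i"] by (auto simp: signed_set_def B_refl_def)
  qed
qed

lemma B_refl_involution:
  assumes "i \<noteq> 0" "j \<noteq> 0" "i \<noteq> j"
  shows "B_refl i j \<circ> B_refl i j = id"
  using assms by (auto simp: fun_eq_iff B_refl_apply)

lemma B_refl_in_B_group:
  assumes "i \<in> signed_set n" "j \<in> signed_set n" "i \<noteq> j"
  shows "B_refl i j \<in> B_group n"
proof (intro B_groupI)
  have nz: "i \<noteq> 0" "j \<noteq> 0" using assms by auto
  show "B_refl i j permutes signed_set n"
    unfolding B_refl_def using assms by (auto intro!: permutes_compose permutes_swap_id)
  show "B_refl i j (- x) = - B_refl i j x" for x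
    using nz assms by (auto simp: B_refl_apply)
qed

lemma odd_fun_comp_B_refl:
  assumes "f \<in> odd_space n" "i \<noteq> 0" "j \<noteq> 0" "i \<noteq> j" "f i = f j"
  shows "f \<circ> B_refl i j = f"
  using assms by (auto simp: fun_eq_iff B_refl_apply parity_space_def)

text \<open>A reflection fixes every odd function with \<open>f i = f j\<close>. These form the
  kernel of a functional with at most three values, so the codimension is at most one.\<close>

lemma card_fixed_B_reflection:
  assumes "t \<in> B_reflections n"
  shows "3 ^ n \<le> 3 * card (fixed_funs (odd_space n) t)"
proof -
  from assms obtain i j where ij: "i \<in> signed_set n" "j \<in> signed_set n" "i \<noteq> j" "t = B_refl i j"
    by (rule B_reflections_cases)
  let ?\<phi> = "\<lambda>f :: int \<Rightarrow> 3. f i - f j"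
  have "3 ^ n = card (?\<phi> ` odd_space n) * card {f \<in> odd_space n. ?\<phi> f = 0}"
    using card_image_times_kernel[of "odd_space n" ?\<phi>] by (simp add: card_parity_space)
  moreover have "card (?\<phi> ` odd_space n) \<le> 3"
    using card_mono[of "UNIV :: 3 set" "?\<phi> ` odd_space n"] by simp
  moreover have "{f \<in> odd_space n. ?\<phi> f = 0} \<subseteq> fixed_funs (odd_space n) t"
    using ij by (auto simp: fixed_funs_def intro!: odd_fun_comp_B_refl)
  then have "card {f \<in> odd_space n. ?\<phi> f = 0} \<le> card (fixed_funs (odd_space n) t)"
    by (intro card_mono) auto
  ultimately show ?thesis by (simp add: mult_le_mono)
qed

text \<open>Codimension of the fixed space is subadditive under composition, since functions fixed
  by both factors are fixed by the product. Hence the length is at least the codimension.\<close>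

lemma card_fixed_product_B_reflections:
  fixes ts :: "(int \<Rightarrow> int) list"
  assumes "set ts \<subseteq> B_reflections n"
  shows "3 ^ n \<le> 3 ^ length ts * card (fixed_funs (odd_space n) (foldr (\<circ>) ts id))"
  using assms
proof (induction ts)
  case Nil
  then show ?case by (simp add: fixed_funs_def o_def card_parity_space)
next
  case (Cons t ts)
  let ?F = "fixed_funs (odd_space n)" and ?\<tau> = "foldr (\<circ>) ts id"
  have "?F t \<inter> ?F ?\<tau> \<subseteq> ?F (t \<circ> ?\<tau>)" by (auto simp: fixed_funs_def fun_eq_iff)
  then have *: "card (?F t \<inter> ?F ?\<tau>) \<le> card (?F (t \<circ> ?\<tau>))" by (intro card_mono) auto
  have "3 ^ n * 3 ^ n \<le> (3 * card (?F t)) * (3 ^ length ts * card (?F ?\<tau>))"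
  proof (rule mult_le_mono)
    show "3 ^ n \<le> 3 * card (?F t)" using Cons.prems by (simp add: card_fixed_B_reflection)
    show "3 ^ n \<le> 3 ^ length ts * card (?F ?\<tau>)" by (rule Cons.IH) (use Cons.prems in auto)
  qed
  also have "\<dots> = 3 ^ length (t # ts) * (card (?F t) * card (?F ?\<tau>))" by simp
  also have "\<dots> \<le> 3 ^ length (t # ts) * (3 ^ n * card (?F (t \<circ> ?\<tau>)))"
    using card_mult_le_card_Int[of "odd_space n" "?F t" "?F ?\<tau>"] *
    by (intro mult_le_mono2) (auto simp: card_parity_space fixed_funs_subset
        intro: order_trans[OF _ mult_le_mono2])
  also have "\<dots> = 3 ^ n * (3 ^ length (t # ts) * card (?F (t \<circ> ?\<tau>)))" by simp
  finally have "3 ^ n \<le> 3 ^ length (t # ts) * card (?F (t \<circ> ?\<tau>))" by simp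
  also have "t \<circ> ?\<tau> = foldr (\<circ>) (t # ts) id" by simp
  finally show ?case .
qed

text \<open>If \<open>\<tau> i = j \<noteq> i\<close>, then the reflection exchanging \<open>i\<close> and \<open>j\<close> makes \<open>i\<close> fixed without
  destroying any invariant function.\<close>
lemma exists_B_reflection_factorization:
  assumes "\<tau> \<in> B_group n"
  shows "\<exists>ts. set ts \<subseteq> B_reflections n \<and> foldr (\<circ>) ts id = \<tau> \<and>
    3 ^ length ts * card (fixed_funs (odd_space n) \<tau>) \<le> 3 ^ n"
  using assms
proof (induction "card {x \<in> signed_set n. \<tau> x \<noteq> x}" arbitrary: \<tau> rule: less_induct)
  case less
  let ?F = "fixed_funs (odd_space n)"
  note perm = B_group_permutes[OF less.prems]
  show ?case
  proof (cases "\<tau> = id")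
    case True
    then show ?thesis
      by (intro exI[of _ "[]"]) (simp add: fixed_funs_def card_parity_space)
  next
    case False
    then obtain i where i: "\<tau> i \<noteq> i" by (auto simp: fun_eq_iff)
    define j where "j = \<tau> i"
    have iX: "i \<in> signed_set n" using i perm by (auto dest: permutes_not_in)
    then have jX: "j \<in> signed_set n" using perm by (simp add: j_def permutes_in_image)
    have nz: "i \<noteq> 0" "j \<noteq> 0" "i \<noteq> j" using iX jX i by (auto simp: j_def)
    define t where "t = B_refl i j"
    define \<sigma> where "\<sigma> = t \<circ> \<tau>"
    have tt: "t \<circ> t = id" using nz by (simp add: t_def B_refl_involution)
    have \<tau>: "\<tau> = t \<circ> \<sigma>" by (simp add: \<sigma>_def comp_assoc[symmetric] tt)
    have \<sigma>B: "\<sigma> \<in> B_group n"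
      unfolding \<sigma>_def t_def using less.prems iX jX nz by (intro B_group_comp B_refl_in_B_group)
    have \<sigma>i: "\<sigma> i = i" using nz by (simp add: \<sigma>_def t_def j_def[symmetric] B_refl_apply)
    \<comment> \<open>Composing with \<open>t\<close> moves no fixed point \<open>x\<close> of
      \<open>\<tau>\<close>: it differs from \<open>i\<close> and \<open>- i\<close>, which are
      moved, and from \<open>j\<close> and \<open>- j\<close>, as
      \<open>\<tau> x = j = \<tau> i\<close> would force \<open>x = i\<close>.\<close>
    have keep: "\<sigma> x = x" if "\<tau> x = x" for x
    proof -
      have "\<tau> (- x) = - x" using that by (simp add: B_group_uminus[OF less.prems])
      then have "x \<noteq> i" "x \<noteq> - i" using i that by (auto simp: B_group_uminus[OF less.prems])
      moreover from this have "\<tau> x \<noteq> j" "\<tau> (- x) \<noteq> j"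
        unfolding j_def using permutes_inj[OF perm] by (auto dest!: injD)
      then have "x \<noteq> j" "x \<noteq> - j" using that \<open>\<tau> (- x) = - x\<close> by auto
      ultimately show ?thesis using nz that by (simp add: \<sigma>_def t_def B_refl_apply)
    qed
    have "card {x \<in> signed_set n. \<sigma> x \<noteq> x} < card {x \<in> signed_set n. \<tau> x \<noteq> x}"
      using iX i \<sigma>i keep by (intro psubset_card_mono) auto
    from less.hyps[OF this \<sigma>B] obtain ts where ts: "set ts \<subseteq> B_reflections n"
      "foldr (\<circ>) ts id = \<sigma>" "3 ^ length ts * card (?F \<sigma>) \<le> 3 ^ n" by blast
    \<comment> \<open>The line spanned by the odd point mass at \<open>i\<close>. It is fixed by
      \<open>\<sigma>\<close> and meets the \<open>\<tau>\<close>-invariant functions only in zero,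
      so passing to \<open>\<sigma>\<close> gains a factor of at least 3, which pays for the
      reflection \<open>t\<close>.\<close>
    define D where "D = range (\<lambda>c x. c * delta (- 1) i x)"
    have "additive_subgroup D"
      unfolding additive_subgroup_def
    proof (intro conjI ballI)
      have "(\<lambda>x. 0 * delta (- 1) i x) \<in> D" unfolding D_def by (rule rangeI)
      then show "0 \<in> D" by (simp add: zero_fun_def)
      fix f g assume "f \<in> D" "g \<in> D"
      then obtain b c where "f = (\<lambda>x. b * delta (- 1) i x)" "g = (\<lambda>x. c * delta (- 1) i x)"
        unfolding D_def by blast
      then have "f - g = (\<lambda>x. (b - c) * delta (- 1) i x)"
        by (simp add: fun_eq_iff left_diff_distrib)
      then show "f - g \<in> D" unfolding D_def by blast
    qed
    have "card D = 3"
    proof -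
      have "inj (\<lambda>c x. c * delta (- 1) i x)"
        by (intro injI) (auto simp: fun_eq_iff delta_def dest!: spec[of _ i])
      then show ?thesis by (simp add: D_def card_image)
    qed
    have "?F \<tau> \<subseteq> ?F \<sigma>"
    proof
      fix f assume f: "f \<in> ?F \<tau>"
      then have "f i = f j" by (auto simp: fixed_funs_def j_def fun_eq_iff)
      then have "f \<circ> t = f" unfolding t_def using f nz
        by (intro odd_fun_comp_B_refl) (auto simp: fixed_funs_def)
      then show "f \<in> ?F \<sigma>" using f by (simp add: fixed_funs_def \<sigma>_def comp_assoc[symmetric])
    qed
    moreover have "D \<subseteq> ?F \<sigma>"
    proof
      fix f assume "f \<in> D"
      then obtain c where c: "f = (\<lambda>x. c * delta (- 1) i x)" unfolding D_def by blast
      have "f \<in> odd_space n" using delta_in_parity_space[OF iX, of "- 1"]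
        by (auto simp: c parity_space_def fun_space_def)
      moreover have "\<sigma> (- i) = - i" using \<sigma>i by (simp add: B_group_uminus[OF \<sigma>B])
      then have "\<sigma> x = i \<longleftrightarrow> x = i" "\<sigma> x = - i \<longleftrightarrow> x = - i" for x
        using permutes_inj[OF B_group_permutes[OF \<sigma>B]] \<sigma>i by (metis injD)+
      then have "f \<circ> \<sigma> = f" by (simp add: c fun_eq_iff delta_def)
      ultimately show "f \<in> ?F \<sigma>" by (simp add: fixed_funs_def)
    qed
    moreover have "?F \<tau> \<inter> D = {0}"
    proof -
      have "f = 0" if "f \<in> ?F \<tau>" "f \<in> D" for f
      proof -
        obtain c where c: "f = (\<lambda>x. c * delta (- 1) i x)"
          using \<open>f \<in> D\<close> unfolding D_def by blast
        have "f i = f j" using that by (auto simp: fixed_funs_def j_def fun_eq_iff)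
        \<comment> \<open>Either \<open>j = - i\<close>, and then \<open>c = - c\<close>, or the
          function vanishes at \<open>j\<close>.\<close>
        then have "c = 0" using nz three_eq_minus_iff[of c]
          by (auto simp: c delta_def split: if_splits)
        then show ?thesis by (simp add: c fun_eq_iff)
      qed
      moreover have "0 \<in> ?F \<tau>" "0 \<in> D"
        using \<open>additive_subgroup D\<close> by (simp_all add: additive_subgroup_zero)
      ultimately show ?thesis by auto
    qed
    ultimately have "card (?F \<tau>) * 3 \<le> card (?F \<sigma>)"
      using card_mult_le_card_Int[of "?F \<sigma>" "?F \<tau>" D] \<open>additive_subgroup D\<close> \<open>card D = 3\<close> by simp
    then have "3 ^ length (t # ts) * card (?F \<tau>) \<le> 3 ^ length ts * card (?F \<sigma>)"
      by (simp add: mult.commute)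
    also note ts(3)
    finally show ?thesis
      using ts B_refl_in_B_reflections[OF iX jX nz(3)]
      by (intro exI[of _ "t # ts"]) (auto simp: t_def[symmetric] \<tau>)
  qed
qed

section \<open>Reflection length as codimension\<close>

lemma B_length_le:
  fixes ts :: "(int \<Rightarrow> int) list"
  shows "set ts \<subseteq> B_reflections n \<Longrightarrow> B_length n (foldr (\<circ>) ts id) \<le> length ts"
  unfolding B_length_def by (rule Least_le) blast

lemma B_length_witness:
  assumes "\<tau> \<in> B_group n"
  obtains ts where "set ts \<subseteq> B_reflections n" "foldr (\<circ>) ts id = \<tau>" "length ts = B_length n \<tau>"
proof -
  have "\<exists>k ts. length ts = k \<and> set ts \<subseteq> B_reflections n \<and> foldr (\<circ>) ts id = \<tau>"
    using exists_B_reflection_factorization[OF assms] by blast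
  from LeastI_ex[OF this] show thesis
    using that unfolding B_length_def by blast
qed

text \<open>Carter's lemma in counting form. The greedy factorization bounds the length from above,
  subadditivity of codimension from below.\<close>

lemma card_fixed_eq_B_length:
  assumes "\<tau> \<in> B_group n"
  shows "3 ^ B_length n \<tau> * card (fixed_funs (odd_space n) \<tau>) = 3 ^ n"
proof (rule antisym)
  obtain ts where ts: "set ts \<subseteq> B_reflections n" "foldr (\<circ>) ts id = \<tau>"
    "3 ^ length ts * card (fixed_funs (odd_space n) \<tau>) \<le> 3 ^ n"
    using exists_B_reflection_factorization[OF assms] by blast
  have "B_length n \<tau> \<le> length ts" using B_length_le[OF ts(1)] ts(2) by simp
  then have "(3::nat) ^ B_length n \<tau> \<le> 3 ^ length ts" by simp
  then show "3 ^ B_length n \<tau> * card (fixed_funs (odd_space n) \<tau>) \<le> 3 ^ n"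
    using ts(3) by (meson le_trans mult_le_mono1)
  obtain ts where "set ts \<subseteq> B_reflections n" "foldr (\<circ>) ts id = \<tau>" "length ts = B_length n \<tau>"
    using B_length_witness[OF assms] .
  then show "3 ^ n \<le> 3 ^ B_length n \<tau> * card (fixed_funs (odd_space n) \<tau>)"
    using card_fixed_product_B_reflections by metis
qed

lemma B_length_comp_le:
  assumes "\<sigma> \<in> B_group n" "\<tau> \<in> B_group n"
  shows "B_length n (\<sigma> \<circ> \<tau>) \<le> B_length n \<sigma> + B_length n \<tau>"
proof -
  obtain ss where ss: "set ss \<subseteq> B_reflections n" "foldr (\<circ>) ss id = \<sigma>" "length ss = B_length n \<sigma>"
    using B_length_witness[OF assms(1)] .
  obtain ts where ts: "set ts \<subseteq> B_reflections n" "foldr (\<circ>) ts id = \<tau>" "length ts = B_length n \<tau>"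
    using B_length_witness[OF assms(2)] .
  have "foldr (\<circ>) ss \<tau>' = foldr (\<circ>) ss id \<circ> \<tau>'" for \<tau>' :: "int \<Rightarrow> int"
    by (induction ss) (auto simp: comp_assoc)
  then have "foldr (\<circ>) (ss @ ts) id = \<sigma> \<circ> \<tau>" by (simp add: ss ts)
  then show ?thesis using B_length_le[of "ss @ ts" n] ss ts by simp
qed

lemma B_length_eq_zero:
  assumes "\<tau> \<in> B_group n" "B_length n \<tau> = 0"
  shows "\<tau> = id"
proof -
  obtain ts where "foldr (\<circ>) ts id = \<tau>" "length ts = B_length n \<tau>"
    using B_length_witness[OF assms(1)] .
  then show ?thesis using assms(2) by simp
qed

section \<open>The absolute order\<close>

text \<open>The fixed functions of \<open>inv \<tau> \<circ> \<sigma>\<close>, transported by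
  composition with \<open>inv \<tau>\<close>. In this form they can be intersected and compared
  directly with the fixed functions of \<open>\<sigma>\<close> and \<open>\<tau>\<close>.\<close>

definition agreement :: "nat \<Rightarrow> (int \<Rightarrow> int) \<Rightarrow> (int \<Rightarrow> int) \<Rightarrow> (int \<Rightarrow> 3) set" where
  "agreement n \<sigma> \<tau> = {f \<in> odd_space n. f \<circ> \<sigma> = f \<circ> \<tau>}"

lemma finite_agreement [simp]: "finite (agreement n \<sigma> \<tau>)"
  by (simp add: agreement_def)

lemma additive_subgroup_agreement [simp]: "additive_subgroup (agreement n \<sigma> \<tau>)"
  using additive_subgroup_parity_space[of n "- 1"]
  by (auto simp: additive_subgroup_def agreement_def fun_diff_def fun_eq_iff)

lemma agreement_subset: "agreement n \<sigma> \<tau> \<subseteq> odd_space n"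
  by (auto simp: agreement_def)

lemma card_agreement:
  assumes "\<sigma> \<in> B_group n" "\<tau> \<in> B_group n"
  shows "card (agreement n \<sigma> \<tau>) = card (fixed_funs (odd_space n) (Hilbert_Choice.inv \<tau> \<circ> \<sigma>))"
proof -
  have inv: "\<tau> \<circ> Hilbert_Choice.inv \<tau> = id" "Hilbert_Choice.inv \<tau> \<circ> \<tau> = id"
    using permutes_inv_o[OF B_group_permutes[OF assms(2)]] by auto
  have cancel: "f \<circ> \<tau> \<circ> Hilbert_Choice.inv \<tau> = f" "f \<circ> Hilbert_Choice.inv \<tau> \<circ> \<tau> = f"
    for f :: "int \<Rightarrow> 3"
    by (simp_all only: comp_assoc inv comp_id)
  have "bij_betw (\<lambda>f. f \<circ> \<tau>) (agreement n \<sigma> \<tau>)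
    (fixed_funs (odd_space n) (Hilbert_Choice.inv \<tau> \<circ> \<sigma>))"
  proof (rule bij_betw_byWitness[where f' = "\<lambda>f. f \<circ> Hilbert_Choice.inv \<tau>"])
    show "(\<lambda>f. f \<circ> \<tau>) ` agreement n \<sigma> \<tau> \<subseteq> fixed_funs (odd_space n) (Hilbert_Choice.inv \<tau> \<circ> \<sigma>)"
    proof clarify
      fix f assume f: "f \<in> agreement n \<sigma> \<tau>"
      have "f \<circ> \<tau> \<circ> (Hilbert_Choice.inv \<tau> \<circ> \<sigma>) = f \<circ> \<sigma>"
        by (simp only: comp_assoc[symmetric] cancel)
      then show "f \<circ> \<tau> \<in> fixed_funs (odd_space n) (Hilbert_Choice.inv \<tau> \<circ> \<sigma>)"
        using f assms(2) by (simp add: agreement_def fixed_funs_def comp_in_parity_space)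
    qed
    show "(\<lambda>f. f \<circ> Hilbert_Choice.inv \<tau>) ` fixed_funs (odd_space n) (Hilbert_Choice.inv \<tau> \<circ> \<sigma>)
      \<subseteq> agreement n \<sigma> \<tau>"
    proof clarify
      fix f assume f: "f \<in> fixed_funs (odd_space n) (Hilbert_Choice.inv \<tau> \<circ> \<sigma>)"
      have "f \<circ> Hilbert_Choice.inv \<tau> \<circ> \<sigma> = f \<circ> Hilbert_Choice.inv \<tau> \<circ> \<tau>"
        using f by (simp only: cancel) (simp add: fixed_funs_def comp_assoc)
      then show "f \<circ> Hilbert_Choice.inv \<tau> \<in> agreement n \<sigma> \<tau>"
        using f B_group_inv[OF assms(2)]
        by (simp add: agreement_def fixed_funs_def comp_in_parity_space)
    qed
  qed (simp_all only: cancel, simp_all)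
  then show ?thesis by (rule bij_betw_same_card)
qed

text \<open>In terms of lengths, \<open>le\<close> says that \<open>\<tau>\<close> lies below
  \<open>\<gamma>\<close>. If \<open>f \<circ> \<gamma> = f \<circ> \<tau>\<close>, then
  \<open>f \<circ> \<gamma> - f\<close> is orthogonal to all \<open>\<tau>\<close>-invariant
  functions. Since \<open>\<gamma>\<close> fixes no nonzero odd function, \<open>f\<close> is
  determined by \<open>f \<circ> \<gamma> - f\<close>; this bounds the right-hand side by the size
  of the orthogonal complement, and \<open>le\<close> forces equality.\<close>

lemma agreement_eq_perp:
  assumes \<gamma>: "\<gamma> \<in> B_group n" "fixed_funs (odd_space n) \<gamma> = {0}" and \<tau>: "\<tau> \<in> B_group n"
    and le: "3 ^ n \<le> card (fixed_funs (odd_space n) \<tau>) *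
      card (fixed_funs (odd_space n) (Hilbert_Choice.inv \<tau> \<circ> \<gamma>))"
  shows "agreement n \<gamma> \<tau> =
    {f \<in> odd_space n. \<forall>y\<in>fixed_funs (odd_space n) \<tau>. dot n ((f \<circ> \<gamma>) - f) y = 0}" (is "_ = ?K")
proof (rule card_seteq)
  let ?F = "fixed_funs (odd_space n) \<tau>"
  let ?P = "{v \<in> odd_space n. \<forall>w\<in>?F. dot n v w = 0}"
  show "finite ?K" by simp
  show "agreement n \<gamma> \<tau> \<subseteq> ?K"
  proof
    fix f assume f: "f \<in> agreement n \<gamma> \<tau>"
    have "dot n ((f \<circ> \<gamma>) - f) y = 0" if "y \<in> ?F" for y
    proof -
      have "dot n (f \<circ> \<gamma>) y = dot n (f \<circ> \<tau>) (y \<circ> \<tau>)"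
        using f that by (simp add: agreement_def fixed_funs_def)
      also have "\<dots> = dot n f y" by (rule dot_comp[OF B_group_permutes[OF \<tau>]])
      finally show ?thesis by (simp add: dot_diff_left)
    qed
    then show "f \<in> ?K" using f by (simp add: agreement_def)
  qed
  have "inj_on (\<lambda>f. (f \<circ> \<gamma>) - f) ?K"
  proof (rule inj_onI)
    fix f g assume fg: "f \<in> ?K" "g \<in> ?K" "(f \<circ> \<gamma>) - f = (g \<circ> \<gamma>) - g"
    have "(f - g) \<circ> \<gamma> = f - g"
    proof
      fix x show "((f - g) \<circ> \<gamma>) x = (f - g) x"
        using fun_cong[OF fg(3), of x] by (simp add: algebra_simps)
    qed
    then have "f - g \<in> fixed_funs (odd_space n) \<gamma>"
      using fg by (simp add: fixed_funs_def additive_subgroup_diff)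
    then show "f = g" using \<gamma>(2) by simp
  qed
  then have "card ?K = card ((\<lambda>f. (f \<circ> \<gamma>) - f) ` ?K)" by (simp add: card_image)
  also have "\<dots> \<le> card ?P"
    using \<gamma>(1) by (intro card_mono) (auto simp: additive_subgroup_diff comp_in_parity_space)
  finally have "card ?F * card ?K \<le> card ?F * card ?P" by (rule mult_le_mono2)
  also have "\<dots> = 3 ^ n" by (rule card_perp_parity_space) (simp_all add: fixed_funs_subset)
  finally have "card ?F * card ?K \<le> 3 ^ n" .
  then have "card ?F * card ?K \<le> card ?F * card (agreement n \<gamma> \<tau>)"
    unfolding card_agreement[OF \<gamma>(1) \<tau>] using le by (rule order_trans)
  moreover have "0 < card ?F"
    using additive_subgroup_zero[of ?F] by (auto simp: card_gt_0_iff)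
  ultimately show "card ?K \<le> card (agreement n \<gamma> \<tau>)" by simp
qed

text \<open>Every \<open>\<tau> \<le> \<gamma>\<close> agrees with \<open>\<gamma>\<close> on a space that depends only on the \<open>\<tau>\<close>-invariant functions.
  This is the argument of Brady and Watt for the orthogonal group.\<close>
lemma B_le_if_fixed_subset:
  assumes \<gamma>: "\<gamma> \<in> B_group n" "fixed_funs (odd_space n) \<gamma> = {0}"
    and \<sigma>: "\<sigma> \<in> B_group n" and \<tau>: "\<tau> \<in> B_group n"
    and \<sigma>_le: "3 ^ n \<le> card (fixed_funs (odd_space n) \<sigma>) *
      card (fixed_funs (odd_space n) (Hilbert_Choice.inv \<sigma> \<circ> \<gamma>))"
    and \<tau>_le: "3 ^ n \<le> card (fixed_funs (odd_space n) \<tau>) *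
      card (fixed_funs (odd_space n) (Hilbert_Choice.inv \<tau> \<circ> \<gamma>))"
    and sub: "fixed_funs (odd_space n) \<tau> \<subseteq> fixed_funs (odd_space n) \<sigma>"
  shows "B_le n \<sigma> \<tau>"
proof -
  let ?F = "fixed_funs (odd_space n)" and ?\<rho> = "Hilbert_Choice.inv \<sigma> \<circ> \<tau>"
  have \<rho>: "?\<rho> \<in> B_group n" using \<sigma> \<tau> by (intro B_group_comp B_group_inv)
  \<comment> \<open>The larger fixed space of \<open>\<sigma>\<close> imposes more orthogonality
    conditions.\<close>
  have "agreement n \<gamma> \<sigma> \<subseteq> agreement n \<gamma> \<tau>"
    unfolding agreement_eq_perp[OF \<gamma> \<sigma> \<sigma>_le] agreement_eq_perp[OF \<gamma> \<tau> \<tau>_le] using sub by blast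
  then have "agreement n \<gamma> \<sigma> \<subseteq> agreement n \<tau> \<sigma>"
    by (auto simp: agreement_def)
  moreover have "?F \<tau> \<subseteq> agreement n \<tau> \<sigma>"
    using sub by (auto simp: agreement_def fixed_funs_def)
  \<comment> \<open>A \<open>\<tau>\<close>-invariant function is \<open>\<sigma>\<close>-invariant
    by \<open>sub\<close>; if \<open>\<gamma>\<close> and \<open>\<sigma>\<close> also agree on it,
    it is \<open>\<gamma>\<close>-invariant, hence zero.\<close>
  moreover have "agreement n \<gamma> \<sigma> \<inter> ?F \<tau> \<subseteq> ?F \<gamma>"
    using sub by (auto simp: agreement_def fixed_funs_def)
  then have "agreement n \<gamma> \<sigma> \<inter> ?F \<tau> = {0}"
    using \<gamma>(2) additive_subgroup_zero[of "agreement n \<gamma> \<sigma> \<inter> ?F \<tau>"]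
    by (auto simp: additive_subgroup_Int)
  ultimately have "card (agreement n \<gamma> \<sigma>) * card (?F \<tau>) \<le> card (agreement n \<tau> \<sigma>)"
    using card_mult_le_card_Int[of "agreement n \<tau> \<sigma>" "agreement n \<gamma> \<sigma>" "?F \<tau>"] by simp
  then have le: "card (?F (Hilbert_Choice.inv \<sigma> \<circ> \<gamma>)) * card (?F \<tau>) \<le> card (?F ?\<rho>)"
    using card_agreement[OF \<gamma>(1) \<sigma>] card_agreement[OF \<tau> \<sigma>] by simp
  have pos: "0 < card (?F \<tau>)"
    using additive_subgroup_zero[of "?F \<tau>"] by (auto simp: card_gt_0_iff)
  have "3 ^ n * card (?F \<tau>) \<le> card (?F \<sigma>) * (card (?F (Hilbert_Choice.inv \<sigma> \<circ> \<gamma>)) * card (?F \<tau>))"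
    using \<sigma>_le by (simp add: mult.assoc[symmetric])
  also have "\<dots> \<le> card (?F \<sigma>) * card (?F ?\<rho>)" using le by (rule mult_le_mono2)
  finally have 1: "3 ^ n * card (?F \<tau>) \<le> card (?F \<sigma>) * card (?F ?\<rho>)" .
  \<comment> \<open>Powers of 3 turn the count of fixed functions into an inequality of lengths; the
    converse inequality is the triangle inequality.\<close>
  have "3 ^ (n + B_length n \<sigma> + B_length n ?\<rho>) * card (?F \<tau>)
    = (3 ^ B_length n \<sigma> * 3 ^ B_length n ?\<rho>) * (3 ^ n * card (?F \<tau>))"
    by (simp add: power_add)
  also have "\<dots> \<le> (3 ^ B_length n \<sigma> * 3 ^ B_length n ?\<rho>) * (card (?F \<sigma>) * card (?F ?\<rho>))"
    using 1 by (rule mult_le_mono2)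
  also have "\<dots> = (3 ^ B_length n \<sigma> * card (?F \<sigma>)) * (3 ^ B_length n ?\<rho> * card (?F ?\<rho>))"
    by simp
  also have "\<dots> = 3 ^ n * (3 ^ B_length n \<tau> * card (?F \<tau>))"
    by (simp only: card_fixed_eq_B_length[OF \<sigma>] card_fixed_eq_B_length[OF \<rho>]
        card_fixed_eq_B_length[OF \<tau>])
  also have "\<dots> = 3 ^ (n + B_length n \<tau>) * card (?F \<tau>)" by (simp add: power_add)
  finally have "(3::nat) ^ (n + B_length n \<sigma> + B_length n ?\<rho>) \<le> 3 ^ (n + B_length n \<tau>)"
    using pos by simp
  then have "B_length n \<sigma> + B_length n ?\<rho> \<le> B_length n \<tau>" by simp
  moreover have "B_length n (\<sigma> \<circ> ?\<rho>) \<le> B_length n \<sigma> + B_length n ?\<rho>"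
    by (rule B_length_comp_le[OF \<sigma> \<rho>])
  moreover have "\<sigma> \<circ> ?\<rho> = \<tau>"
    by (simp add: comp_assoc[symmetric] permutes_inv_o[OF B_group_permutes[OF \<sigma>]])
  ultimately show ?thesis by (simp add: B_le_def)
qed

text \<open>A function fixed by \<open>\<sigma>\<close> on which \<open>\<sigma>\<close> and
  \<open>\<tau>\<close> agree is fixed by \<open>\<tau>\<close>. Additivity of lengths makes the
  space of such functions at least as large as the fixed space of \<open>\<tau>\<close>, so the two
  coincide.\<close>

lemma fixed_subset_if_B_le:
  assumes \<sigma>: "\<sigma> \<in> B_group n" and \<tau>: "\<tau> \<in> B_group n" and le: "B_le n \<sigma> \<tau>"
  shows "fixed_funs (odd_space n) \<tau> \<subseteq> fixed_funs (odd_space n) \<sigma>"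
proof -
  let ?F = "fixed_funs (odd_space n)" and ?\<rho> = "Hilbert_Choice.inv \<sigma> \<circ> \<tau>"
  let ?I = "?F \<sigma> \<inter> agreement n \<tau> \<sigma>"
  have \<rho>: "?\<rho> \<in> B_group n" using \<sigma> \<tau> by (intro B_group_comp B_group_inv)
  have I: "card (?F \<sigma>) * card (?F ?\<rho>) \<le> 3 ^ n * card ?I"
    using card_mult_le_card_Int[of "odd_space n" "?F \<sigma>" "agreement n \<tau> \<sigma>"]
    by (simp add: card_parity_space fixed_funs_subset agreement_subset card_agreement[OF \<tau> \<sigma>])
  have "3 ^ n * (3 ^ B_length n \<tau> * card (?F \<tau>))
    = (3 ^ B_length n \<sigma> * card (?F \<sigma>)) * (3 ^ B_length n ?\<rho> * card (?F ?\<rho>))"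
    by (simp only: card_fixed_eq_B_length[OF \<sigma>] card_fixed_eq_B_length[OF \<rho>]
        card_fixed_eq_B_length[OF \<tau>])
  also have "\<dots> = 3 ^ B_length n \<tau> * (card (?F \<sigma>) * card (?F ?\<rho>))"
    using le by (simp add: B_le_def power_add)
  also have "\<dots> \<le> 3 ^ B_length n \<tau> * (3 ^ n * card ?I)" using I by (rule mult_le_mono2)
  finally have "card (?F \<tau>) \<le> card ?I" by simp
  moreover have "?I \<subseteq> ?F \<tau>" by (auto simp: agreement_def fixed_funs_def)
  ultimately have "?I = ?F \<tau>" by (intro card_seteq) auto
  then show ?thesis by auto
qed

text \<open>Equal fixed spaces give equal lengths, so \<open>inv \<sigma> \<circ> \<tau>\<close> has
  length zero.\<close>

lemma eq_if_fixed_eq: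
  assumes \<sigma>: "\<sigma> \<in> B_group n" and \<tau>: "\<tau> \<in> B_group n" and le: "B_le n \<sigma> \<tau>"
    and eq: "fixed_funs (odd_space n) \<tau> = fixed_funs (odd_space n) \<sigma>"
  shows "\<sigma> = \<tau>"
proof -
  let ?\<rho> = "Hilbert_Choice.inv \<sigma> \<circ> \<tau>"
  have \<rho>: "?\<rho> \<in> B_group n" using \<sigma> \<tau> by (intro B_group_comp B_group_inv)
  have pos: "0 < card (fixed_funs (odd_space n) \<sigma>)"
    using additive_subgroup_zero[of "fixed_funs (odd_space n) \<sigma>"] by (auto simp: card_gt_0_iff)
  have "3 ^ B_length n \<sigma> * card (fixed_funs (odd_space n) \<sigma>)
    = 3 ^ B_length n \<tau> * card (fixed_funs (odd_space n) \<sigma>)"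
    using card_fixed_eq_B_length[OF \<sigma>] card_fixed_eq_B_length[OF \<tau>] eq by simp
  then have "B_length n \<sigma> = B_length n \<tau>" using pos by (auto simp: card_gt_0_iff)
  then have "B_length n ?\<rho> = 0" using le by (simp add: B_le_def)
  then have "?\<rho> = id" by (rule B_length_eq_zero[OF \<rho>])
  then have "\<sigma> \<circ> ?\<rho> = \<sigma>" by simp
  moreover have "\<sigma> \<circ> ?\<rho> = \<tau>"
    by (simp add: comp_assoc[symmetric] permutes_inv_o[OF B_group_permutes[OF \<sigma>]])
  ultimately show ?thesis by simp
qed

section \<open>Noncrossing permutations\<close>

lemma permutes_permutation: "\<tau> permutes signed_set n \<Longrightarrow> permutation \<tau>"
  unfolding permutation_permutes using finite_signed_set by blast

lemma fixed_funs_orbit: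
  assumes "f \<circ> \<tau> = f" "y \<in> Orbits.orbit \<tau> x"
  shows "f y = f x"
  using assms(2) by induction (use fun_cong[OF assms(1)] in auto)

lemma card_signed_set: "card (signed_set n) = 2 * n"
proof -
  have "signed_set n = {1..int n} \<union> {- int n..- 1}" by (auto simp: signed_set_def)
  then show ?thesis by (simp add: card_Un_disjoint)
qed

text \<open>Distinct functions on the set of orbits pull back to distinct invariant
  functions.\<close>

lemma card_fixed_ge_orbits:
  assumes "\<tau> permutes signed_set n"
  shows "3 ^ card (perm_orbits (signed_set n) \<tau>) \<le> card (fixed_funs (fun_space n) \<tau>)"
proof -
  let ?O = "perm_orbits (signed_set n) \<tau>"
  let ?g = "\<lambda>g x. if x \<in> signed_set n then g (Orbits.orbit \<tau> x) else (0::3)"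
  have "finite ?O"
    by (simp add: perm_orbits_def Setcompr_eq_image)
  have "inj_on ?g (?O \<rightarrow>\<^sub>E UNIV)"
  proof (rule inj_onI)
    fix g h :: "int set \<Rightarrow> 3"
    assume gh: "g \<in> ?O \<rightarrow>\<^sub>E UNIV" "h \<in> ?O \<rightarrow>\<^sub>E UNIV" "?g g = ?g h"
    show "g = h"
    proof (rule PiE_ext[OF gh(1,2)])
      fix A assume "A \<in> ?O"
      then obtain x where "x \<in> signed_set n" "A = Orbits.orbit \<tau> x" by (auto simp: perm_orbits_def)
      then show "g A = h A" using fun_cong[OF gh(3), of x] by simp
    qed
  qed
  moreover have "?g ` (?O \<rightarrow>\<^sub>E UNIV) \<subseteq> fixed_funs (fun_space n) \<tau>"
    using assms permutation_orbit_step[OF permutes_permutation[OF assms]]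
    by (auto simp: fixed_funs_def fun_space_def fun_eq_iff permutes_in_image)
  ultimately have "card (?O \<rightarrow>\<^sub>E (UNIV :: 3 set)) \<le> card (fixed_funs (fun_space n) \<tau>)"
    by (intro card_inj_on_le[of ?g]) auto
  then show ?thesis using \<open>finite ?O\<close> by (simp add: card_funcsetE)
qed

lemma fixed_by_generate:
  assumes "\<tau> permutes S" "\<gamma> permutes S" "f \<circ> \<tau> = f" "f \<circ> \<gamma> = f"
    and "g \<in> generate (perm_group S) {\<tau>, \<gamma>}"
  shows "f \<circ> g = f"
  using assms(5)
proof induction
  case one
  then show ?case by (simp add: perm_group_def)
next
  case (incl h)
  then have "h = \<tau> \<or> h = \<gamma>" by simp
  then show ?case using assms(3,4) by metis
next
  case (inv h)
  then have h: "h permutes S" "f \<circ> h = f" using assms by auto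
  note o = permutes_inv_o[OF h(1)]
  \<comment> \<open>\<open>m_inv\<close> is a definite description, identified with the inverse
    function by uniqueness of a right inverse.\<close>
  have "m_inv (perm_group S) h = Hilbert_Choice.inv h"
    unfolding m_inv_def
  proof (rule the_equality)
    show "Hilbert_Choice.inv h \<in> carrier (perm_group S) \<and>
      h \<otimes>\<^bsub>perm_group S\<^esub> Hilbert_Choice.inv h = \<one>\<^bsub>perm_group S\<^esub> \<and>
      Hilbert_Choice.inv h \<otimes>\<^bsub>perm_group S\<^esub> h = \<one>\<^bsub>perm_group S\<^esub>"
      using h by (simp add: perm_group_def permutes_inv permutes_inv_o)
    fix k assume "k \<in> carrier (perm_group S) \<and> h \<otimes>\<^bsub>perm_group S\<^esub> k = \<one>\<^bsub>perm_group S\<^esub> \<and>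
      k \<otimes>\<^bsub>perm_group S\<^esub> h = \<one>\<^bsub>perm_group S\<^esub>"
    then have "h \<circ> k = id" by (simp add: perm_group_def)
    then show "k = Hilbert_Choice.inv h"
      using o by (metis comp_assoc comp_id id_comp)
  qed
  moreover have "f \<circ> Hilbert_Choice.inv h = f"
    using h(2) o by (metis comp_assoc comp_id)
  ultimately show ?case by simp
next
  case (eng h1 h2)
  then have "f \<circ> (h1 \<circ> h2) = f" by (metis comp_assoc)
  then show ?case by (simp add: perm_group_def o_def)
qed

text \<open>A function invariant under both generators is constant on the orbits of the generated
  group, hence determined by its values at chosen representatives.\<close>

lemma card_fixed_le_joint_orbits:
  assumes "\<tau> permutes signed_set n" "\<gamma> permutes signed_set n"
  shows "card (fixed_funs (fun_space n) \<tau> \<inter> fixed_funs (fun_space n) \<gamma>)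
    \<le> 3 ^ card (joint_orbits (signed_set n) \<tau> \<gamma>)"
proof -
  let ?S = "signed_set n"
  let ?J = "joint_orbits ?S \<tau> \<gamma>" and ?G = "generate (perm_group ?S) {\<tau>, \<gamma>}"
  let ?orb = "\<lambda>x. {g x | g. g \<in> ?G}"
  let ?r = "\<lambda>f :: int \<Rightarrow> 3. restrict (\<lambda>A. f (SOME x. x \<in> A)) ?J"
  have J: "?J = ?orb ` ?S"
    by (auto simp: joint_orbits_def orbits_def Group_Action.orbit_def)
  have "id \<in> ?G"
    using generate.one[of "perm_group ?S" "{\<tau>, \<gamma>}"] by (simp add: perm_group_def)
  then have "id x \<in> ?orb x" for x by blast
  then have self: "x \<in> ?orb x" for x by simp
  have const: "f (SOME y. y \<in> ?orb x) = f x"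
    if "f \<in> fixed_funs (fun_space n) \<tau> \<inter> fixed_funs (fun_space n) \<gamma>" for f x
  proof -
    have "(SOME y. y \<in> ?orb x) \<in> ?orb x" by (rule someI) (rule self)
    then obtain g where "g \<in> ?G" "(SOME y. y \<in> ?orb x) = g x" by blast
    moreover have "f \<circ> g = f"
      using that fixed_by_generate[OF assms _ _ \<open>g \<in> ?G\<close>] by (auto simp: fixed_funs_def)
    ultimately show ?thesis by (metis comp_apply)
  qed
  have "inj_on ?r (fixed_funs (fun_space n) \<tau> \<inter> fixed_funs (fun_space n) \<gamma>)"
  proof (rule inj_onI, rule ext)
    fix f h x
    assume f: "f \<in> fixed_funs (fun_space n) \<tau> \<inter> fixed_funs (fun_space n) \<gamma>"
      and h: "h \<in> fixed_funs (fun_space n) \<tau> \<inter> fixed_funs (fun_space n) \<gamma>"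
      and eq: "?r f = ?r h"
    show "f x = h x"
    proof (cases "x \<in> ?S")
      case True
      then have "?orb x \<in> ?J" unfolding J by (rule imageI)
      then have "f (SOME y. y \<in> ?orb x) = h (SOME y. y \<in> ?orb x)"
        using fun_cong[OF eq, of "?orb x"] by simp
      then show ?thesis by (simp only: const[OF f] const[OF h])
    next
      case False
      then show ?thesis using f h by (auto simp: fixed_funs_def fun_space_def)
    qed
  qed
  moreover have "finite ?J" unfolding J by simp
  ultimately have "card (fixed_funs (fun_space n) \<tau> \<inter> fixed_funs (fun_space n) \<gamma>)
    \<le> card (?J \<rightarrow>\<^sub>E (UNIV :: 3 set))"
    by (intro card_inj_on_le[of ?r]) (auto intro: finite_PiE)
  then show ?thesis using \<open>finite ?J\<close> by (simp add: card_funcsetE)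
qed

text \<open>Twice the even and odd parts determine \<open>f\<close>, as 2 is invertible modulo 3,
  and they stay invariant because \<open>\<tau>\<close> commutes with negation.\<close>

lemma card_fixed_le_even_odd:
  assumes "\<tau> \<in> B_group n"
  shows "card (fixed_funs (fun_space n) \<tau>) \<le>
    card (fixed_funs (even_space n) \<tau>) * card (fixed_funs (odd_space n) \<tau>)"
proof -
  let ?h = "\<lambda>f :: int \<Rightarrow> 3. ((\<lambda>x. f x + f (- x)), (\<lambda>x. f x - f (- x)))"
  have "inj ?h"
  proof (rule injI, rule ext)
    fix f g x assume "?h f = ?h g"
    then have 1: "f x + f (- x) = g x + g (- x)" "f x - f (- x) = g x - g (- x)"
      by (auto simp: fun_eq_iff)
    have "(f x - g x) + (f x - g x) = (f x + f (- x)) + (f x - f (- x)) - (g x + g (- x)) - (g x - g (- x))"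
      by (simp add: algebra_simps)
    also have "\<dots> = 0" by (simp add: 1)
    finally show "f x = g x" using three_double_eq_zero[of "f x - g x"] by simp
  qed
  moreover have "?h ` fixed_funs (fun_space n) \<tau> \<subseteq>
      fixed_funs (even_space n) \<tau> \<times> fixed_funs (odd_space n) \<tau>"
  proof (rule image_subsetI)
    fix f assume f: "f \<in> fixed_funs (fun_space n) \<tau>"
    then have "f (\<tau> x) = f x" for x by (auto simp: fixed_funs_def fun_eq_iff)
    then show "?h f \<in> fixed_funs (even_space n) \<tau> \<times> fixed_funs (odd_space n) \<tau>"
      using f B_group_uminus[OF assms, symmetric]
      by (auto simp: fixed_funs_def parity_space_def fun_space_def fun_eq_iff add.commute)
  qed
  ultimately have "card (fixed_funs (fun_space n) \<tau>) \<le>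
    card (fixed_funs (even_space n) \<tau> \<times> fixed_funs (odd_space n) \<tau>)"
    by (intro card_inj_on_le[of ?h]) (auto intro: inj_on_subset)
  then show ?thesis by (simp add: card_cartesian_product)
qed

text \<open>For \<open>\<gamma>\<close>-invariant \<open>h\<close> we have \<open>h - h \<circ> \<tau> = h - h \<circ> \<tau>'\<^sup>-\<^sup>1\<close> with \<open>\<tau>' = \<tau>\<^sup>-\<^sup>1\<gamma>\<close>, so these functions
  are orthogonal to all functions invariant under \<open>\<tau>\<close> or \<open>\<tau>'\<close>. This bounds the even invariant
  functions from above, and genus zero then bounds the odd ones from below.\<close>
lemma card_fixed_odd_noncrossing:
  assumes \<gamma>: "\<gamma> \<in> B_group n" and \<tau>: "\<tau> \<in> B_group n" and nc: "\<tau> \<in> S_nc (signed_set n) \<gamma>"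
    and even: "fixed_funs (fun_space n) \<gamma> \<subseteq> even_space n"
  shows "3 ^ n \<le> card (fixed_funs (odd_space n) \<tau>) *
      card (fixed_funs (odd_space n) (Hilbert_Choice.inv \<tau> \<circ> \<gamma>))"
proof -
  let ?S = "signed_set n"
  define \<tau>' where "\<tau>' = Hilbert_Choice.inv \<tau> \<circ> \<gamma>"
  have \<tau>': "\<tau>' \<in> B_group n" unfolding \<tau>'_def using \<gamma> \<tau> by (intro B_group_comp B_group_inv)
  note perm = B_group_permutes[OF \<gamma>] B_group_permutes[OF \<tau>] B_group_permutes[OF \<tau>']
  have comp: "\<tau> \<circ> \<tau>' = \<gamma>"
    by (simp add: \<tau>'_def comp_assoc[symmetric] permutes_inv_o[OF perm(2)])
  let ?F = "fixed_funs (fun_space n)" and ?E = "fixed_funs (even_space n)"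
    and ?O = "fixed_funs (odd_space n)"
  \<comment> \<open>\<open>D\<close> is the sum of the even invariant spaces of
    \<open>\<tau>\<close> and \<open>\<tau>'\<close>. \<open>U\<close> measures how far
    \<open>\<tau>\<close> moves the \<open>\<gamma>\<close>-invariant functions; the kernel is
    \<open>J\<close>. Orthogonality of \<open>D\<close> and \<open>U\<close> gives
    \<open>UD\<close>.\<close>
  define D where "D = (\<lambda>(f, g). f - g) ` (?E \<tau> \<times> ?E \<tau>')"
  define U where "U = (\<lambda>h. h - (h \<circ> \<tau>)) ` ?F \<gamma>"
  define J where "J = ?F \<tau> \<inter> ?F \<gamma>"
  have add: "(a - b) - ((a - b) \<circ> \<tau>) = (a - (a \<circ> \<tau>)) - (b - (b \<circ> \<tau>))" for a b :: "int \<Rightarrow> 3"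
    by (auto simp: fun_eq_iff)
  have "{h \<in> ?F \<gamma>. h - (h \<circ> \<tau>) = 0} = J"
    by (auto simp: J_def fixed_funs_def)
  then have UJ: "card (?F \<gamma>) = card U * card J"
    using card_image_times_kernel[of "?F \<gamma>" "\<lambda>h. h - (h \<circ> \<tau>)"] add by (simp add: U_def)
  have "additive_subgroup U"
    unfolding additive_subgroup_def
  proof (intro conjI ballI)
    have "0 \<in> ?F \<gamma>" by (simp add: additive_subgroup_zero)
    moreover have "0 = 0 - (0 \<circ> \<tau> :: int \<Rightarrow> 3)" by (auto simp: fun_eq_iff)
    ultimately show "0 \<in> U" unfolding U_def by (intro image_eqI)
    fix u v assume "u \<in> U" "v \<in> U"
    then obtain a b where ab: "a \<in> ?F \<gamma>" "u = a - (a \<circ> \<tau>)" "b \<in> ?F \<gamma>" "v = b - (b \<circ> \<tau>)"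
      unfolding U_def by blast
    then have "u - v = (a - b) - ((a - b) \<circ> \<tau>)" by (simp only: add)
    then show "u - v \<in> U"
      unfolding U_def using ab
      by (intro image_eqI[of _ _ "a - b"]) (simp_all add: additive_subgroup_diff)
  qed
  \<comment> \<open>Here the inversion-invariance of the orbits of \<open>\<gamma>\<close> enters,
    through \<open>even\<close>: it places \<open>U\<close> in the even space, of dimension
    \<open>n\<close> only.\<close>
  moreover have "U \<subseteq> even_space n"
    using even \<tau> by (auto simp: U_def additive_subgroup_diff comp_in_parity_space subset_iff)
  ultimately have perp: "card U * card {v \<in> even_space n. \<forall>w\<in>U. dot n v w = 0} = 3 ^ n"
    by (intro card_perp_parity_space) auto
  have "D \<subseteq> {v \<in> even_space n. \<forall>w\<in>U. dot n v w = 0}"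
  proof
    fix v assume "v \<in> D"
    then obtain f g where fg: "f \<in> ?E \<tau>" "g \<in> ?E \<tau>'" "v = f - g" by (auto simp: D_def)
    have "dot n v w = 0" if "w \<in> U" for w
    proof -
      from that obtain h where h: "h \<in> ?F \<gamma>" "w = h - (h \<circ> \<tau>)" by (auto simp: U_def)
      have "dot n f (h \<circ> \<tau>) = dot n (f \<circ> \<tau>) (h \<circ> \<tau>)" using fg by (simp add: fixed_funs_def)
      also have "\<dots> = dot n f h" by (rule dot_comp[OF perm(2)])
      finally have 1: "dot n f (h \<circ> \<tau>) = dot n f h" .
      have "dot n g (h \<circ> \<tau>) = dot n (g \<circ> \<tau>') (h \<circ> \<tau> \<circ> \<tau>')" by (rule dot_comp[OF perm(3), symmetric])
      also have "\<dots> = dot n g h" using fg h by (simp add: fixed_funs_def comp_assoc comp)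
      finally have 2: "dot n g (h \<circ> \<tau>) = dot n g h" .
      show ?thesis by (simp add: h fg dot_diff_left dot_diff_right 1 2)
    qed
    moreover have "v \<in> even_space n"
      using fg by (simp add: fixed_funs_def additive_subgroup_diff)
    ultimately show "v \<in> {v \<in> even_space n. \<forall>w\<in>U. dot n v w = 0}" by simp
  qed
  then have "card D \<le> card {v \<in> even_space n. \<forall>w\<in>U. dot n v w = 0}" by (intro card_mono) auto
  then have UD: "card U * card D \<le> 3 ^ n"
    unfolding perp[symmetric] by (rule mult_le_mono2)
  have "?E \<tau> \<inter> ?E \<tau>' \<subseteq> J"
  proof
    fix f assume f: "f \<in> ?E \<tau> \<inter> ?E \<tau>'"
    then have "f \<circ> \<gamma> = f" unfolding comp[symmetric] comp_assoc[symmetric]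
      by (simp add: fixed_funs_def)
    then show "f \<in> J" using f by (auto simp: J_def fixed_funs_def parity_space_def)
  qed
  then have "card (?E \<tau> \<inter> ?E \<tau>') \<le> card J" by (intro card_mono) (auto simp: J_def)
  then have EE: "card (?E \<tau>) * card (?E \<tau>') \<le> card D * card J"
    using card_diffs_times_Int[of "?E \<tau>" "?E \<tau>'"] by (simp add: D_def)
  let ?a = "card (perm_orbits ?S \<tau>)" and ?a' = "card (perm_orbits ?S \<tau>')"
    and ?g = "card (perm_orbits ?S \<gamma>)" and ?c = "card (joint_orbits ?S \<tau> \<gamma>)"
  have Jc: "card J \<le> 3 ^ ?c"
    unfolding J_def by (rule card_fixed_le_joint_orbits[OF perm(2,1)])
  have lower: "3 ^ ?a \<le> card (?E \<tau>) * card (?O \<tau>)" "3 ^ ?a' \<le> card (?E \<tau>') * card (?O \<tau>')"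
    "3 ^ ?g \<le> card U * card J"
    using card_fixed_ge_orbits[OF perm(2)] card_fixed_le_even_odd[OF \<tau>]
      card_fixed_ge_orbits[OF perm(3)] card_fixed_le_even_odd[OF \<tau>']
      card_fixed_ge_orbits[OF perm(1)] UJ by linarith+
  \<comment> \<open>The genus zero equation, with \<open>n + n\<close> elements in \<open>X\<close>.
    Exponentiated, it confronts the bounds \<open>lower\<close> with \<open>EE\<close>,
    \<open>UD\<close> and \<open>Jc\<close>. The factor \<open>card J\<close> arises twice, from
    \<open>EE\<close> and from \<open>UJ\<close>, matching the two copies of
    \<open>?c\<close>.\<close>
  have "?a + ?a' + ?g = n + n + ?c + ?c"
    using nc by (simp add: S_nc_def \<tau>'_def card_signed_set)
  then have "(3::nat) ^ n * 3 ^ ?c * 3 ^ ?c * 3 ^ n = 3 ^ ?a * 3 ^ ?a' * 3 ^ ?g"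
    by (simp add: power_add[symmetric] add_ac)
  also have "\<dots> \<le> (card (?E \<tau>) * card (?O \<tau>)) * (card (?E \<tau>') * card (?O \<tau>')) * (card U * card J)"
    using lower by (intro mult_le_mono)
  also have "\<dots> = (card (?E \<tau>) * card (?E \<tau>')) * (card U * card J * (card (?O \<tau>) * card (?O \<tau>')))"
    by (simp only: mult_ac)
  also have "\<dots> \<le> (card D * card J) * (card U * card J * (card (?O \<tau>) * card (?O \<tau>')))"
    using EE by (rule mult_le_mono1)
  also have "\<dots> = (card U * card D) * card J * card J * (card (?O \<tau>) * card (?O \<tau>'))"
    by (simp only: mult_ac)
  also have "\<dots> \<le> 3 ^ n * 3 ^ ?c * 3 ^ ?c * (card (?O \<tau>) * card (?O \<tau>'))"
    using UD Jc by (intro mult_le_mono) auto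
  finally show ?thesis by (simp add: \<tau>'_def)
qed

section \<open>Orbit partitions\<close>

lemma B_group_orbit_uminus:
  assumes "\<tau> \<in> B_group n"
  shows "Orbits.orbit \<tau> (- x) = uminus ` Orbits.orbit \<tau> x"
proof -
  have sub: "- y \<in> Orbits.orbit \<tau> (- x)" if "y \<in> Orbits.orbit \<tau> x" for x y
    using that
  proof induction
    case base
    then show ?case using orbit.base[of \<tau> "- x"] by (simp add: B_group_uminus[OF assms])
  next
    case (step y)
    from orbit.step[OF step.IH] show ?case by (simp add: B_group_uminus[OF assms])
  qed
  from sub[of _ x] sub[of _ "- x"] show ?thesis
    by (force simp: image_iff)
qed

text \<open>The function is 1 on the orbit, -1 on its negative and 0 elsewhere. It is odd because an
  orbit that is not inversion-invariant is disjoint from its negative.\<close>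

lemma odd_separating_function:
  assumes \<tau>: "\<tau> \<in> B_group n" and x: "x \<in> signed_set n"
    and nz: "Orbits.orbit \<tau> x \<noteq> uminus ` Orbits.orbit \<tau> x"
  obtains f where "f \<in> fixed_funs (odd_space n) \<tau>"
    "\<And>y. f y = 1 \<longleftrightarrow> y \<in> Orbits.orbit \<tau> x"
proof -
  note perm = B_group_permutes[OF \<tau>]
  let ?A = "Orbits.orbit \<tau> x"
  let ?f = "\<lambda>y. if y \<in> ?A then 1 else if - y \<in> ?A then - 1 else (0 :: 3)"
  have eq: "Orbits.orbit \<tau> y = ?A" if "y \<in> ?A" for y
    using that cyclic_on_orbit[OF perm] by (intro orbit_cyclic_eq3) auto
  have disj: "- y \<notin> ?A" if "y \<in> ?A" for y
    using nz eq[OF that] eq[of "- y"] B_group_orbit_uminus[OF \<tau>, of y] by metis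
  have sub: "?A \<subseteq> signed_set n" by (rule permutes_orbit_subset[OF perm x])
  have step: "\<tau> y \<in> ?A \<longleftrightarrow> y \<in> ?A" for y
  proof
    assume "\<tau> y \<in> ?A"
    then have "Orbits.orbit \<tau> y = ?A"
      using eq[of "\<tau> y"] permutation_orbit_step[OF permutes_permutation[OF perm], of y] by simp
    then show "y \<in> ?A" using permutation_self_in_orbit[OF permutes_permutation[OF perm]] by blast
  qed (rule orbit.step)
  have "?f \<in> fixed_funs (odd_space n) \<tau>"
    using sub disj step step[of "- y" for y] uminus_in_signed_set[of _ n]
    by (auto simp: fixed_funs_def parity_space_def fun_space_def fun_eq_iff
        B_group_uminus[OF \<tau>, symmetric] simp del: uminus_in_signed_set)
  then show thesis by (rule that) auto
qed

text \<open>On a zero-block an odd invariant function satisfies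
  \<open>f x = f (- x) = - f x\<close>, so it vanishes: such functions cannot tell zero-blocks
  apart, which is the merging. Every other orbit is cut out by a separating function.\<close>

lemma Omega_tilde_eq_quotient:
  assumes \<tau>: "\<tau> \<in> B_group n"
  shows "Omega_tilde n \<tau> =
    (\<lambda>x. {y \<in> signed_set n. \<forall>f\<in>fixed_funs (odd_space n) \<tau>. f y = f x}) ` signed_set n"
    (is "_ = ?cl ` ?X")
proof -
  note perm = B_group_permutes[OF \<tau>]
  let ?orb = "Orbits.orbit \<tau>" and ?F = "fixed_funs (odd_space n) \<tau>"
  have self: "x \<in> ?orb x" for x
    by (rule permutation_self_in_orbit[OF permutes_permutation[OF perm]])
  have eq: "?orb y = ?orb x" if "y \<in> ?orb x" for x y
    using that cyclic_on_orbit[OF perm] by (intro orbit_cyclic_eq3) auto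
  have sub: "?orb x \<subseteq> ?X" if "x \<in> ?X" for x by (rule permutes_orbit_subset[OF perm that])
  have const: "f y = f x" if "f \<in> ?F" "y \<in> ?orb x" for f x y
    using that fixed_funs_orbit[of f \<tau>] by (auto simp: fixed_funs_def)
  let ?zero = "\<lambda>x. ?orb x = uminus ` ?orb x"
  have zero: "f x = 0" if "f \<in> ?F" "?zero x" for f x
  proof -
    have "- x \<in> ?orb x" using that(2) self[of x] by auto
    then have "f (- x) = f x" using that const by blast
    then show ?thesis using that three_eq_minus_iff[of "f x"]
      by (auto simp: fixed_funs_def parity_space_def)
  qed
  have nonzero_class: "?cl x = ?orb x" if x: "x \<in> ?X" "\<not> ?zero x" for x
  proof
    obtain f where f: "f \<in> ?F" "\<And>y. f y = 1 \<longleftrightarrow> y \<in> ?orb x"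
      using odd_separating_function[OF \<tau> x] by blast
    show "?cl x \<subseteq> ?orb x"
    proof clarify
      fix y assume "\<forall>f\<in>?F. f y = f x"
      then have "f y = f x" using f(1) by blast
      then show "y \<in> ?orb x" using f(2) self[of x] by metis
    qed
    show "?orb x \<subseteq> ?cl x" using sub[OF x(1)] const by auto
  qed
  have zero_class: "?cl x = {y \<in> ?X. ?zero y}" if x: "x \<in> ?X" "?zero x" for x
  proof (intro equalityI subsetI)
    fix y assume y: "y \<in> ?cl x"
    have "?zero y"
    proof (rule ccontr)
      assume "\<not> ?zero y"
      moreover have "y \<in> ?X" using y by simp
      ultimately obtain f where "f \<in> ?F" "\<And>z. f z = 1 \<longleftrightarrow> z \<in> ?orb y"
        using odd_separating_function[OF \<tau>] by metis
      then have "f y = 1" "f y = f x" "f x = 0" using self y zero x by auto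
      then show False by simp
    qed
    then show "y \<in> {y \<in> ?X. ?zero y}" using y by simp
  next
    fix y assume y: "y \<in> {y \<in> ?X. ?zero y}"
    have "f y = f x" if "f \<in> ?F" for f
      using zero[OF that, of x] zero[OF that, of y] x y by simp
    then show "y \<in> ?cl x" using y by simp
  qed
  define Z where "Z = zero_blocks (Omega n \<tau>)"
  have Om: "Omega n \<tau> = ?orb ` ?X" by (auto simp: Omega_def perm_orbits_def)
  have Z: "Z = ?orb ` {x \<in> ?X. ?zero x}" unfolding Z_def zero_blocks_def Om by auto
  have rest: "Omega n \<tau> - Z = ?orb ` {x \<in> ?X. \<not> ?zero x}"
    unfolding Z_def zero_blocks_def Om by auto
  have UZ: "\<Union> Z = {x \<in> ?X. ?zero x}"
  proof
    show "\<Union> Z \<subseteq> {x \<in> ?X. ?zero x}"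
      unfolding Z using eq sub by (fastforce simp: subset_iff)
    show "{x \<in> ?X. ?zero x} \<subseteq> \<Union> Z" unfolding Z using self by blast
  qed
  have 1: "?cl ` {x \<in> ?X. \<not> ?zero x} = Omega n \<tau> - Z"
    unfolding rest by (intro image_cong refl nonzero_class) auto
  have split: "?cl ` ?X = ?cl ` {x \<in> ?X. ?zero x} \<union> ?cl ` {x \<in> ?X. \<not> ?zero x}"
    by blast
  show ?thesis
  proof (cases "Z = {}")
    case True
    then have none: "{x \<in> ?X. ?zero x} = {}" using UZ by simp
    have "?cl ` ?X = Omega n \<tau>" unfolding split 1 unfolding none True by simp
    moreover have "Omega_tilde n \<tau> = Omega n \<tau>"
      using True by (simp add: Omega_tilde_def Let_def Z_def)
    ultimately show ?thesis by simp
  next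
    case False
    have "?cl ` {x \<in> ?X. ?zero x} = (\<lambda>_. \<Union> Z) ` {x \<in> ?X. ?zero x}"
      unfolding UZ by (intro image_cong refl zero_class) auto
    also have "\<dots> = {\<Union> Z}" using False unfolding Z by auto
    finally have "?cl ` ?X = insert (\<Union> Z) (Omega n \<tau> - Z)" unfolding split 1 by simp
    moreover have "Omega_tilde n \<tau> = insert (\<Union> Z) (Omega n \<tau> - Z)"
      using False by (simp add: Omega_tilde_def Let_def Z_def)
    ultimately show ?thesis by simp
  qed
qed

text \<open>Under refinement, \<open>x\<close> and \<open>\<sigma> x\<close> share a class of
  \<open>\<sigma>\<close>, hence one of \<open>\<tau>\<close>, so each
  \<open>\<tau>\<close>-invariant odd function is \<open>\<sigma>\<close>-invariant. Conversely,
  more functions give finer classes.\<close>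

lemma rev_refines_Omega_tilde_iff:
  assumes \<sigma>: "\<sigma> \<in> B_group n" and \<tau>: "\<tau> \<in> B_group n"
  shows "rev_refines (Omega_tilde n \<sigma>) (Omega_tilde n \<tau>) \<longleftrightarrow>
    fixed_funs (odd_space n) \<tau> \<subseteq> fixed_funs (odd_space n) \<sigma>"
proof -
  let ?X = "signed_set n" and ?F = "fixed_funs (odd_space n)"
  let ?cl = "\<lambda>\<tau> x. {y \<in> ?X. \<forall>f\<in>?F \<tau>. f y = f x}"
  show ?thesis
    unfolding Omega_tilde_eq_quotient[OF \<sigma>] Omega_tilde_eq_quotient[OF \<tau>]
  proof
    assume ref: "rev_refines (?cl \<sigma> ` ?X) (?cl \<tau> ` ?X)"
    show "?F \<tau> \<subseteq> ?F \<sigma>"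
    proof
      fix f assume f: "f \<in> ?F \<tau>"
      have "f (\<sigma> x) = f x" for x
      proof (cases "x \<in> ?X")
        case True
        then obtain C where C: "C \<subseteq> ?cl \<sigma> ` ?X" "?cl \<tau> x = \<Union> C"
          using ref unfolding rev_refines_def by blast
        have "x \<in> ?cl \<tau> x" using True by simp
        then obtain c where c: "c \<in> C" "x \<in> c" unfolding C(2) by (rule UnionE)
        then obtain z where z: "c = ?cl \<sigma> z" using C(1) by auto
        have "\<sigma> x \<in> ?X" using True permutes_in_image[OF B_group_permutes[OF \<sigma>]] by simp
        then have "\<sigma> x \<in> c" using c(2) unfolding z by (auto simp: fixed_funs_def fun_eq_iff)
        then have "\<sigma> x \<in> ?cl \<tau> x" unfolding C(2) using c(1) by (rule UnionI[rotated])
        then show ?thesis using f by blast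
      next
        case False
        then show ?thesis using permutes_not_in[OF B_group_permutes[OF \<sigma>]] by simp
      qed
      then show "f \<in> ?F \<sigma>" using f by (simp add: fixed_funs_def fun_eq_iff)
    qed
  next
    assume sub: "?F \<tau> \<subseteq> ?F \<sigma>"
    show "rev_refines (?cl \<sigma> ` ?X) (?cl \<tau> ` ?X)"
      unfolding rev_refines_def
    proof
      fix B assume "B \<in> ?cl \<tau> ` ?X"
      then obtain x where x: "x \<in> ?X" "B = ?cl \<tau> x" by blast
      have "?cl \<sigma> y \<subseteq> B" if "y \<in> B" for y
        using that sub unfolding x(2) by fastforce
      moreover have "y \<in> ?cl \<sigma> y" "y \<in> ?X" if "y \<in> B" for y using that x(2) by auto
      ultimately have "?cl \<sigma> ` B \<subseteq> ?cl \<sigma> ` ?X" "B = \<Union> (?cl \<sigma> ` B)" by blast+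
      then show "\<exists>C\<subseteq>?cl \<sigma> ` ?X. B = \<Union> C" by blast
    qed
  qed
qed

section \<open>The annular permutation\<close>

text \<open>Rotating the list by half its length negates every entry.\<close>

lemma cycle_antipodal:
  assumes "distinct (as @ map uminus as)" and x: "x \<in> set (as @ map uminus as)"
  shows "(cycle_of_list (as @ map uminus as) ^^ length as) x = - (x :: int)"
proof -
  let ?cs = "as @ map uminus as"
  from x obtain k where k: "k < length ?cs" "x = ?cs ! k" by (metis in_set_conv_nth)
  have "map (cycle_of_list ?cs ^^ length as) ?cs = rotate (length as) ?cs"
    by (rule cyclic_rotation) (rule assms)
  also have "\<dots> = map uminus ?cs" by (simp add: rotate_append comp_def)
  finally show ?thesis using k by (metis nth_map)
qed

text \<open>On its support, negation is a power of the cycle, hence commutes with it.\<close>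

lemma cycle_uminus:
  assumes "distinct (as @ map uminus as)" and x: "x \<in> set (as @ map uminus as)"
  shows "cycle_of_list (as @ map uminus as) (- x) = - (cycle_of_list (as @ map uminus as) x :: int)"
proof -
  let ?c = "cycle_of_list (as @ map uminus as)"
  have "?c x \<in> set (as @ map uminus as)"
    using x permutes_in_image[OF cycle_permutes] by metis
  then have "- ?c x = (?c ^^ length as) (?c x)" using cycle_antipodal[OF assms(1)] by simp
  also have "\<dots> = ?c ((?c ^^ length as) x)" by (metis funpow_swap1)
  finally show ?thesis using cycle_antipodal[OF assms] by simp
qed

text \<open>The two cycles have disjoint supports covering \<open>X\<close>. Half a turn of either
  one is negation, so an invariant function takes equal values at \<open>x\<close> and
  \<open>- x\<close>.\<close>

lemma annular_gamma_in_B_group: "annular_gamma p q \<in> B_group (p + q)"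
  and annular_gamma_fixed_even:
    "fixed_funs (fun_space (p + q)) (annular_gamma p q) \<subseteq> even_space (p + q)"
proof -
  define as where "as = [1..int p]"
  define bs where "bs = [int p + 1..int (p + q)]"
  define a where "a = cycle_of_list (as @ map uminus as)"
  define b where "b = cycle_of_list (bs @ map uminus bs)"
  let ?A = "set (as @ map uminus as)" and ?B = "set (bs @ map uminus bs)"
  let ?X = "signed_set (p + q)"
  have \<gamma>: "annular_gamma p q = a \<circ> b" by (simp add: annular_gamma_def a_def b_def as_def bs_def)
  have da: "distinct (as @ map uminus as)" and db: "distinct (bs @ map uminus bs)"
    by (auto simp: as_def bs_def distinct_map)
  have disj: "?A \<inter> ?B = {}" by (auto simp: as_def bs_def)
  have X: "?X = ?A \<union> ?B"
  proof -
    have "?A = {x. 1 \<le> \<bar>x\<bar> \<and> \<bar>x\<bar> \<le> int p}"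
      by (auto simp: as_def image_iff abs_le_iff intro!: bexI[of _ "- x" for x])
    moreover have "?B = {x. int p + 1 \<le> \<bar>x\<bar> \<and> \<bar>x\<bar> \<le> int (p + q)}"
      by (auto simp: bs_def image_iff abs_le_iff intro!: bexI[of _ "- x" for x])
    ultimately show ?thesis by (auto simp: signed_set_def)
  qed
  have pa: "a permutes ?A" and pb: "b permutes ?B"
    unfolding a_def b_def by (rule cycle_permutes)+
  have onA: "(a \<circ> b) x = a x" if "x \<in> ?A" for x
  proof -
    have "x \<notin> ?B" using that disj by blast
    then show ?thesis using permutes_not_in[OF pb] by simp
  qed
  have onB: "(a \<circ> b) x = b x" if "x \<in> ?B" for x
  proof -
    have "b x \<in> ?B" using that permutes_in_image[OF pb] by metis
    then have "b x \<notin> ?A" using disj by blast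
    then show ?thesis using permutes_not_in[OF pa] by simp
  qed
  have neg: "- x \<in> ?A \<longleftrightarrow> x \<in> ?A" "- x \<in> ?B \<longleftrightarrow> x \<in> ?B" for x
    by (auto simp: image_iff) (metis add.inverse_inverse)+
  show "annular_gamma p q \<in> B_group (p + q)"
  proof (rule B_groupI)
    show "annular_gamma p q permutes ?X"
      unfolding \<gamma> X by (intro permutes_compose permutes_subset[OF pa] permutes_subset[OF pb]) auto
    fix x assume "x \<in> ?X"
    then consider "x \<in> ?A" | "x \<in> ?B" using X by blast
    then show "annular_gamma p q (- x) = - annular_gamma p q x"
      unfolding \<gamma>
    proof cases
      case 1
      then show "(a \<circ> b) (- x) = - (a \<circ> b) x"
        using onA[of x] onA[of "- x"] neg cycle_uminus[OF da] by (simp only: a_def)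
    next
      case 2
      then show "(a \<circ> b) (- x) = - (a \<circ> b) x"
        using onB[of x] onB[of "- x"] neg cycle_uminus[OF db] by (simp only: b_def)
    qed
  qed
  show "fixed_funs (fun_space (p + q)) (annular_gamma p q) \<subseteq> even_space (p + q)"
  proof
    fix f assume f: "f \<in> fixed_funs (fun_space (p + q)) (annular_gamma p q)"
    then have inv: "f ((a \<circ> b) x) = f x" for x by (auto simp: fixed_funs_def \<gamma> fun_eq_iff)
    have pow: "f ((c ^^ k) x) = f x \<and> (c ^^ k) x \<in> C"
      if "c permutes C" "\<And>x. x \<in> C \<Longrightarrow> (a \<circ> b) x = c x" "x \<in> C" for c C k x
    proof (induction k)
      case (Suc k)
      then show ?case using that inv[of "(c ^^ k) x"] permutes_in_image[OF that(1)] by auto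
    qed (use that in simp)
    have "f (- x) = f x" for x
    proof -
      consider "x \<in> ?A" | "x \<in> ?B" | "x \<notin> ?X" using X by blast
      then show ?thesis
      proof cases
        case 1
        then show ?thesis
          using pow[OF pa onA 1, of "length as"] cycle_antipodal[OF da 1] by (simp only: a_def)
      next
        case 2
        then show ?thesis
          using pow[OF pb onB 2, of "length bs"] cycle_antipodal[OF db 2] by (simp only: b_def)
      next
        case 3
        then show ?thesis using f by (auto simp: fixed_funs_def fun_space_def)
      qed
    qed
    then show "f \<in> even_space (p + q)" using f by (simp add: parity_space_def fixed_funs_def)
  qed
qed

lemma fixed_odd_trivial:
  assumes "fixed_funs (fun_space n) \<gamma> \<subseteq> even_space n"
  shows "fixed_funs (odd_space n) \<gamma> = {0}"
proof -
  have "f = 0" if f: "f \<in> fixed_funs (odd_space n) \<gamma>" for f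
  proof
    fix x
    have "f \<in> even_space n" using f assms by (auto simp: fixed_funs_def parity_space_def)
    then have "f (- x) = f x" by (simp add: parity_space_def)
    moreover have "f (- x) = - f x" using f by (simp add: fixed_funs_def parity_space_def)
    ultimately show "f x = 0 x" using three_eq_minus_iff[of "f x"] by simp
  qed
  moreover have "0 \<in> fixed_funs (odd_space n) \<gamma>" by (simp add: additive_subgroup_zero)
  ultimately show ?thesis by auto
qed

section \<open>Both orders as reverse inclusion of fixed spaces\<close>

theorem theorem1p4:
  fixes p q n :: nat
  assumes "p > 0" and "q > 0" and "n = p + q"
  shows "bij_betw (Omega_tilde n) (S_ncB p q) (NCB p q) \<and>
    poset_isomorphism
      (S_ncB p q) (induced_order (S_ncB p q) (B_le n))
      (NCB p q) (induced_order (NCB p q) rev_refines)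
      (Omega_tilde n)"
proof -
  let ?\<gamma> = "annular_gamma p q" and ?F = "fixed_funs (odd_space n)" and ?S = "S_ncB p q"
  have \<gamma>: "?\<gamma> \<in> B_group n" and even: "fixed_funs (fun_space n) ?\<gamma> \<subseteq> even_space n"
    using annular_gamma_in_B_group annular_gamma_fixed_even assms(3) by auto
  note trivial = fixed_odd_trivial[OF even]
  have B: "\<tau> \<in> B_group n" if "\<tau> \<in> ?S" for \<tau> using that assms(3) by (simp add: S_ncB_def)
  have lower: "3 ^ n \<le> card (?F \<tau>) * card (?F (Hilbert_Choice.inv \<tau> \<circ> ?\<gamma>))" if "\<tau> \<in> ?S" for \<tau>
    using that assms(3) B[OF that] \<gamma> even
    by (intro card_fixed_odd_noncrossing) (simp_all add: S_ncB_def)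
  \<comment> \<open>Together with \<open>ref_iff\<close>, this reduces the order axioms and the
    isomorphism to facts about inclusion, with antisymmetry supplied by \<open>inj\<close>.\<close>
  have le_iff: "B_le n \<sigma> \<tau> \<longleftrightarrow> ?F \<tau> \<subseteq> ?F \<sigma>" if "\<sigma> \<in> ?S" "\<tau> \<in> ?S" for \<sigma> \<tau>
    using B_le_if_fixed_subset[OF \<gamma> trivial B[OF that(1)] B[OF that(2)]
        lower[OF that(1)] lower[OF that(2)]]
      fixed_subset_if_B_le[OF B[OF that(1)] B[OF that(2)]] by blast
  have ref_iff: "rev_refines (Omega_tilde n \<sigma>) (Omega_tilde n \<tau>) \<longleftrightarrow> ?F \<tau> \<subseteq> ?F \<sigma>"
    if "\<sigma> \<in> ?S" "\<tau> \<in> ?S" for \<sigma> \<tau>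
    by (rule rev_refines_Omega_tilde_iff[OF B[OF that(1)] B[OF that(2)]])
  have inj: "\<sigma> = \<tau>" if "\<sigma> \<in> ?S" "\<tau> \<in> ?S" "?F \<sigma> = ?F \<tau>" for \<sigma> \<tau>
  proof -
    have "B_le n \<sigma> \<tau>" using le_iff[OF that(1,2)] that(3) by blast
    then show ?thesis by (rule eq_if_fixed_eq[OF B[OF that(1)] B[OF that(2)] _ that(3)[symmetric]])
  qed
  have NCB: "NCB p q = Omega_tilde n ` ?S" unfolding NCB_def assms(3) by blast
  have bij: "bij_betw (Omega_tilde n) ?S (NCB p q)"
    unfolding bij_betw_def NCB
  proof (intro conjI refl inj_onI)
    fix \<sigma> \<tau> assume st: "\<sigma> \<in> ?S" "\<tau> \<in> ?S" and eq: "Omega_tilde n \<sigma> = Omega_tilde n \<tau>"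
    \<comment> \<open>The instance with \<open>\<sigma>\<close> twice shows that the partition
      refines itself; read along \<open>eq\<close>, the other two give both inclusions.\<close>
    have "?F \<sigma> = ?F \<tau>"
      using ref_iff[OF st(1,1)] ref_iff[OF st] ref_iff[OF st(2,1)] unfolding eq by blast
    then show "\<sigma> = \<tau>" by (rule inj[OF st])
  qed
  have "partial_order_on ?S (induced_order ?S (B_le n))"
    unfolding partial_order_on_def preorder_on_def
  proof (intro conjI)
    show "refl_on ?S (induced_order ?S (B_le n))"
      by (auto simp: refl_on_def induced_order_def le_iff)
    show "trans (induced_order ?S (B_le n))"
      by (rule transI) (clarsimp simp: induced_order_def le_iff, blast)
    show "antisym (induced_order ?S (B_le n))"
      by (rule antisymI) (auto simp: induced_order_def le_iff intro: inj)
  qed (auto simp: induced_order_def)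
  moreover have "partial_order_on (NCB p q) (induced_order (NCB p q) rev_refines)"
    unfolding partial_order_on_def preorder_on_def
  proof (intro conjI)
    show "refl_on (NCB p q) (induced_order (NCB p q) rev_refines)"
      by (auto simp: refl_on_def induced_order_def NCB ref_iff)
    show "trans (induced_order (NCB p q) rev_refines)"
      by (rule transI) (clarsimp simp: induced_order_def NCB ref_iff, blast)
    show "antisym (induced_order (NCB p q) rev_refines)"
    proof (rule antisymI)
      fix \<pi> \<rho> assume 1: "(\<pi>, \<rho>) \<in> induced_order (NCB p q) rev_refines"
        "(\<rho>, \<pi>) \<in> induced_order (NCB p q) rev_refines"
      then obtain \<sigma> \<tau> where st: "\<sigma> \<in> ?S" "\<pi> = Omega_tilde n \<sigma>" "\<tau> \<in> ?S" "\<rho> = Omega_tilde n \<tau>"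
        by (auto simp: induced_order_def NCB)
      then have "?F \<sigma> = ?F \<tau>" using 1 by (auto simp: induced_order_def ref_iff)
      then show "\<pi> = \<rho>" using inj st by blast
    qed
  qed (auto simp: induced_order_def)
  moreover have "\<forall>\<sigma>\<in>?S. \<forall>\<tau>\<in>?S. (\<sigma>, \<tau>) \<in> induced_order ?S (B_le n) \<longleftrightarrow>
      (Omega_tilde n \<sigma>, Omega_tilde n \<tau>) \<in> induced_order (NCB p q) rev_refines"
    by (simp add: induced_order_def NCB le_iff ref_iff)
  ultimately show ?thesis using bij unfolding poset_isomorphism_def by blast
qed

end
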